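(* Consider the structured linear-concave-affine isoperimetric control problem described in the context, with admissible control set $\mathcal U\subset L^\infty(0,T;\mathbb R^m)$, payoff $J$, constraint functional $\mathcal C$, and value function $$V(B)=\sup\{J(u): u\in\mathcal U,\ \mathcal C(u)=B\},\qquad B\in\mathbb R,$$ with $V(B)=-\infty$ if no $u\in\mathcal U$ satisfies $\mathcal C(u)=B$, and $\operatorname{dom}V=\mathcal C(\mathcal U)$. Then $\operatorname{dom}V$ is an interval, and $V$ is concave and upper semicontinuous on $\operatorname{dom}V$.
   Context: Structured class. Fix $T>0$, $x_0\in\mathbb R^n$, and a nonempty, compact, convex set $U\subset\mathbb R^m$. Let $\mathcal U=\{u\in L^\infty(0,T;\mathbb R^m): u(t)\in U\text{ for a.e. }t\}$. For $u\in\mathcal U$ let $x_u\in W^{1,\infty}(0,T;\mathbb R^n)$ be the unique solution of $\dot x(t)=A(t)x(t)+B(t)u(t)$, $x(0)=x_0$, where $A,B$ are measurable and bounded matrix functions of sizes $n\times n$ and $n\times m$ (the matrix function $B(\cdot)$ is unrelated to the scalar level $B$). The payoff is $J(u)=\int_0^T f(t,x_u(t),u(t))\,dt+\phi(x_u(T))$, where: $f:[0,T]\times\mathbb R^n\times\mathbb R^m\to\mathbb R$ is measurable in $t$ for each $(x,u)$; $f(t,\cdot,\cdot)$ is $C^1$ for a.e. $t$ and concave (and upper semicontinuous); $|f(t,x,u)|\le c(1+\|x\|^2+\|u\|^2)$ on $[0,T]\times\mathbb R^n\times U$; $\phi\in C^1(\mathbb R^n)$ is concave (and upper semicontinuous)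 with $|\phi(x)|\le c(1+\|x\|^2)$, for some constant $c>0$. It is moreover assumed that $J$ is weak-$*$ upper semicontinuous on $\mathcal U$ (for the weak-$*$ topology of $L^\infty(0,T;\mathbb R^m)=(L^1(0,T;\mathbb R^m))^*$). The constraint functional is $\mathcal C(u)=\int_0^T h(t,x_u(t),u(t))\,dt$ with affine integrand $h(t,x,u)=a(t)^\top x+b(t)^\top u+c_0(t)$, where $a,b,c_0$ are measurable and bounded. *)

theory Defs
  imports "HOL-Analysis.Analysis"
begin

text \<open>
  Elements of \<open>L\<^sup>\<infinity>(0,T)\<close> and \<open>L\<^sup>1(0,T)\<close> are represented by functions \<open>real \<Rightarrow> 'a\<close>; values outside
  \<open>{0..T}\<close> and on null sets are irrelevant to everything below. Measurability is Lebesgue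
  measurability, and \<open>(0,T)\<close> and \<open>[0,T]\<close> are interchangeable since they differ by a null set.
\<close>

definition Linf :: "real \<Rightarrow> (real \<Rightarrow> 'a::euclidean_space) set" where
  "Linf T = {u \<in> borel_measurable (lebesgue_on {0..T}).
               \<exists>K. AE t in lebesgue_on {0..T}. norm (u t) \<le> K}"

definition L1 :: "real \<Rightarrow> (real \<Rightarrow> 'a::euclidean_space) set" where
  "L1 T = {g. integrable (lebesgue_on {0..T}) g}"

text \<open>
  The weak-* topology \<open>\<sigma>(L\<^sup>\<infinity>, L\<^sup>1)\<close>: the initial topology of the pairings
  \<open>u \<mapsto> \<integral> g \<bullet> u\<close>, \<open>g \<in> L\<^sup>1\<close>. On representatives it is the pullback of the usual (Hausdorff)
  topology along the quotient map to a.e. classes, so open sets correspond one to one.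
\<close>

definition weak_star :: "real \<Rightarrow> (real \<Rightarrow> 'a::euclidean_space) topology" where
  "weak_star T = pullback_topology (Linf T)
     (\<lambda>u. \<lambda>g\<in>L1 T. LINT t|lebesgue_on {0..T}. g t \<bullet> u t)
     (powertop_real (L1 T))"

lemma topspace_weak_star [simp]: "topspace (weak_star T) = Linf T"
  by (auto simp: weak_star_def topspace_pullback_topology)

definition usc_map :: "'a topology \<Rightarrow> ('a \<Rightarrow> 'b::linorder) \<Rightarrow> bool" where
  "usc_map X f \<longleftrightarrow> (\<forall>c. openin X {x \<in> topspace X. f x < c})"

definition C1 :: "('a::real_normed_vector \<Rightarrow> real) \<Rightarrow> bool" where
  "C1 F \<longleftrightarrow> (\<exists>F'. (\<forall>z. (F has_derivative blinfun_apply (F' z)) (at z)) \<and> continuous_on UNIV F')"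

text \<open>Excluding the value \<open>-\<infinity>\<close> keeps the sum on the left-hand side free of \<open>\<infinity> - \<infinity>\<close>.\<close>

definition ereal_concave_on :: "'a::real_vector set \<Rightarrow> ('a \<Rightarrow> ereal) \<Rightarrow> bool" where
  "ereal_concave_on S F \<longleftrightarrow> convex S \<and> (\<forall>x\<in>S. F x \<noteq> -\<infinity>) \<and>
     (\<forall>x\<in>S. \<forall>y\<in>S. \<forall>p\<ge>0. \<forall>q\<ge>0. p + q = 1 \<longrightarrow>
        ereal p * F x + ereal q * F y \<le> F (p *\<^sub>R x + q *\<^sub>R y))"

definition admissible :: "real \<Rightarrow> (real^'m) set \<Rightarrow> (real \<Rightarrow> real^'m) set" where
  "admissible T U = {u \<in> Linf T. AE t in lebesgue_on {0..T}. u t \<in> U}"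

text \<open>
  \<open>W\<^sup>1\<^sup>,\<^sup>\<infinity>(0,T)\<close> is the space of Lipschitz functions on \<open>{0..T}\<close>, whose weak derivative is the a.e.
  derivative.
\<close>

definition is_state ::
  "real \<Rightarrow> real^'n \<Rightarrow> (real \<Rightarrow> real^'n^'n) \<Rightarrow> (real \<Rightarrow> real^'m^'n) \<Rightarrow> (real \<Rightarrow> real^'m)
    \<Rightarrow> (real \<Rightarrow> real^'n) \<Rightarrow> bool" where
  "is_state T x0 A B u x \<longleftrightarrow>
     (\<exists>L. L-lipschitz_on {0..T} x) \<and> x 0 = x0 \<and>
     (AE t in lebesgue_on {0..T}.
        (x has_vector_derivative (A t *v x t + B t *v u t)) (at t within {0..T}))"

text \<open>Restricting to \<open>extensional {0..T}\<close> makes the solution on \<open>{0..T}\<close> unique as a total function.\<close>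

definition state ::
  "real \<Rightarrow> real^'n \<Rightarrow> (real \<Rightarrow> real^'n^'n) \<Rightarrow> (real \<Rightarrow> real^'m^'n) \<Rightarrow> (real \<Rightarrow> real^'m)
    \<Rightarrow> real \<Rightarrow> real^'n" where
  "state T x0 A B u = (THE x. x \<in> extensional {0..T} \<and> is_state T x0 A B u x)"

definition payoff ::
  "real \<Rightarrow> real^'n \<Rightarrow> (real \<Rightarrow> real^'n^'n) \<Rightarrow> (real \<Rightarrow> real^'m^'n)
    \<Rightarrow> (real \<Rightarrow> (real^'n) \<times> (real^'m) \<Rightarrow> real) \<Rightarrow> (real^'n \<Rightarrow> real)
    \<Rightarrow> (real \<Rightarrow> real^'m) \<Rightarrow> real" where
  "payoff T x0 A B f \<phi> u =
     (LINT t|lebesgue_on {0..T}. f t (state T x0 A B u t, u t)) + \<phi> (state T x0 A B u T)"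

definition constraint ::
  "real \<Rightarrow> real^'n \<Rightarrow> (real \<Rightarrow> real^'n^'n) \<Rightarrow> (real \<Rightarrow> real^'m^'n)
    \<Rightarrow> (real \<Rightarrow> real^'n) \<Rightarrow> (real \<Rightarrow> real^'m) \<Rightarrow> (real \<Rightarrow> real)
    \<Rightarrow> (real \<Rightarrow> real^'m) \<Rightarrow> real" where
  "constraint T x0 A B a b c\<^sub>0 u =
     (LINT t|lebesgue_on {0..T}. a t \<bullet> state T x0 A B u t + b t \<bullet> u t + c\<^sub>0 t)"

text \<open>The supremum in \<^typ>\<open>ereal\<close> over the empty set is \<open>-\<infinity>\<close>.\<close>

definition value_fun :: "'u set \<Rightarrow> ('u \<Rightarrow> real) \<Rightarrow> ('u \<Rightarrow> real) \<Rightarrow> real \<Rightarrow> ereal" where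
  "value_fun \<U> J C \<beta> = (SUP u\<in>{u \<in> \<U>. C u = \<beta>}. ereal (J u))"

definition value_dom :: "'u set \<Rightarrow> ('u \<Rightarrow> real) \<Rightarrow> real set" where
  "value_dom \<U> C = C ` \<U>"

lemma value_dom_eq: "value_dom \<U> C = {\<beta>. value_fun \<U> J C \<beta> \<noteq> -\<infinity>}"
proof -
  have "value_fun \<U> J C \<beta> \<noteq> -\<infinity>" if "u \<in> \<U>" "C u = \<beta>" for u \<beta>
  proof -
    have "ereal (J u) \<le> value_fun \<U> J C \<beta>"
      unfolding value_fun_def using that by (intro SUP_upper) auto
    then show ?thesis by auto
  qed
  moreover have "value_fun \<U> J C \<beta> = -\<infinity>" if "\<beta> \<notin> C ` \<U>" for \<beta>
  proof -
    have "{u \<in> \<U>. C u = \<beta>} = {}" using that by auto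
    then show ?thesis
      unfolding value_fun_def by (simp only: image_empty Sup_empty bot_ereal_def)
  qed
  ultimately show ?thesis by (auto simp: value_dom_def)
qed

end

theory Submission
  imports Defs
begin

text \<open>
  The value function inherits concavity from the affine dependence of the state on the control. Upper
  semicontinuity amounts to this: if for each \<open>e > 0\<close> some admissible \<open>u\<close> has \<open>J u \<ge> r\<close> and
  \<open>\<bar>C u - \<beta>\<bar> \<le> e\<close>, then some admissible \<open>u\<close> has \<open>J u \<ge> r\<close> and \<open>C u = \<beta>\<close>. Weak-* compactness is
  avoided: the sets \<open>{u. J u \<ge> r \<and> \<bar>C u - \<beta>\<bar> \<le> 1/k}\<close> are nested, convex and bounded in \<open>L\<^sup>2\<close>, so
  elements of almost minimal \<open>L\<^sup>2\<close> norm form a Cauchy sequence, which can be chosen to converge almost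
  everywhere. Bounded a.e. convergence implies weak-* convergence, where \<open>J\<close> is upper semicontinuous, and
  \<open>L\<^sup>1\<close> convergence, where \<open>C\<close> is continuous by Gronwall's inequality.
\<close>

subsection \<open>Lebesgue differentiation and the Gronwall inequality\<close>

text \<open>The coefficients \<open>A\<close> and \<open>B\<close> are merely measurable, so
  trajectories satisfy the equation only almost everywhere, and \<open>state\<close> is a
  description operator that says nothing before existence and uniqueness are known. Existence uses
  the integral equation, uniqueness and stability the a.e. derivative; passing between them needs
  Lebesgue differentiation one way and the fundamental theorem for Lipschitz functions the other
  way. Superlevel sets of \<open>J\<close> are convex because \<open>J\<close> is concave, strips
  around a level of \<open>C\<close> because \<open>C\<close> is affine. Midpoints suffice: if two
  elements are almost minimal and their midpoint cannot have much smaller norm, the parallelogram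
  law forces them together. The minimal squared norms increase along the nested sets and stay
  bounded, so their limit is a common threshold. Geometrically decreasing tolerances make the
  consecutive L1 distances summable, whence a.e. convergence of the sequence itself. No upper bound
  of \<open>J\<close> is established; the concavity argument copes with an infinite supremum in
  \<open>ereal\<close>.\<close>

lemma AE_lebesgue_onE:
  assumes "AE t in lebesgue_on S. P t" "S \<in> sets lebesgue"
  obtains N where "negligible N" "\<And>t. t \<in> S \<Longrightarrow> t \<notin> N \<Longrightarrow> P t"
proof -
  have "AE t in lebesgue. t \<in> S \<longrightarrow> P t"
    using assms by (simp add: AE_restrict_space_iff)
  then have "negligible {t. \<not> (t \<in> S \<longrightarrow> P t)}"
    by (simp add: completion.AE_iff_null_sets negligible_iff_null_sets)
  then show ?thesis using that[of "{t. \<not> (t \<in> S \<longrightarrow> P t)}"] by blast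
qed

lemma AE_lebesgue_onI:
  assumes "negligible N" "\<And>t. t \<in> S \<Longrightarrow> t \<notin> N \<Longrightarrow> P t" "S \<in> sets lebesgue"
  shows "AE t in lebesgue_on S. P t"
proof -
  have "AE t in lebesgue. t \<in> S \<longrightarrow> P t"
    unfolding completion.AE_iff_null_sets negligible_iff_null_sets[symmetric]
    by (rule negligible_subset[OF assms(1)]) (use assms(2) in auto)
  then show ?thesis using assms(3) by (simp add: AE_restrict_space_iff)
qed

text \<open>Rests on completeness of \<open>lebesgue\<close>; extension by zero carries the claim
  from the restricted measure to the whole space.\<close>

lemma borel_measurable_lebesgue_on_AE:
  fixes f g :: "'a::euclidean_space \<Rightarrow> 'b::euclidean_space"
  assumes f: "f \<in> borel_measurable (lebesgue_on S)" and S: "S \<in> sets lebesgue"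
    and ae: "AE t in lebesgue_on S. f t = g t"
  shows "g \<in> borel_measurable (lebesgue_on S)"
proof -
  have "(\<lambda>t. if t \<in> S then f t else 0) \<in> borel_measurable lebesgue"
    using f S by (simp add: borel_measurable_if)
  moreover have "AE t in lebesgue. (if t \<in> S then f t else 0) = (if t \<in> S then g t else 0)"
    using ae S by (auto simp: AE_restrict_space_iff)
  ultimately have "(\<lambda>t. if t \<in> S then g t else 0) \<in> borel_measurable lebesgue"
    by (rule borel_measurable_AE)
  then show ?thesis using S by (simp add: borel_measurable_if)
qed

lemma finite_measure_lebesgue_on_Icc: "finite_measure (lebesgue_on {a..b::real})"
  by (rule finite_measure_lebesgue_on) simp

section \<open>The fundamental theorem of calculus almost everywhere\<close>

lemma has_vector_derivative_iff_difference_quotient: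
  "(x has_vector_derivative d) (at t within S) \<longleftrightarrow>
    ((\<lambda>s. (x s - x t) /\<^sub>R (s - t)) \<longlongrightarrow> d) (at t within S)"
proof -
  have "norm ((x s - x t) - (s - t) *\<^sub>R d) / norm (s - t) = norm ((x s - x t) /\<^sub>R (s - t) - d)"
    if "s \<noteq> t" for s
  proof -
    have "(x s - x t) /\<^sub>R (s - t) - d = ((x s - x t) - (s - t) *\<^sub>R d) /\<^sub>R (s - t)"
      using that by (simp add: scaleR_diff_right)
    then show ?thesis by (simp add: divide_inverse mult.commute)
  qed
  then have "((\<lambda>s. norm ((x s - x t) - (s - t) *\<^sub>R d) / norm (s - t)) \<longlongrightarrow> 0) (at t within S)
      \<longleftrightarrow> ((\<lambda>s. norm ((x s - x t) /\<^sub>R (s - t) - d)) \<longlongrightarrow> 0) (at t within S)"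
    by (intro Lim_cong_within) auto
  then show ?thesis
    unfolding has_vector_derivative_def has_derivative_iff_norm
    by (simp add: bounded_linear_scaleR_left tendsto_norm_zero_iff LIM_zero_iff)
qed

text \<open>Lebesgue differentiation over cubes with lower corner \<open>x\<close>. On the line such
  a cube is \<open>{x..x + h}\<close>, which is why only the right-hand limit comes out.\<close>

lemma AE_right_derivative_indefinite_integral:
  fixes g :: "real \<Rightarrow> 'a::euclidean_space"
  assumes "\<And>a b. g integrable_on {a..b}"
  obtains N where "negligible N"
    "\<And>x. x \<notin> N \<Longrightarrow> ((\<lambda>h. integral {x..x + h} g /\<^sub>R h) \<longlongrightarrow> g x) (at_right 0)"
proof -
  have "\<And>a b. g integrable_on cbox a b" using assms by simp
  then obtain N where N: "negligible N"
    "\<And>x e. \<lbrakk>x \<notin> N; 0 < e\<rbrakk> \<Longrightarrow> \<exists>d>0. \<forall>h. 0 < h \<and> h < d \<longrightarrow>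
        norm (integral (cbox x (x + h *\<^sub>R One)) g /\<^sub>R h ^ DIM(real) - g x) < e"
    by (rule integrable_ccontinuous_explicit) blast
  show ?thesis
  proof (rule that[OF N(1)])
    fix x assume "x \<notin> N"
    show "((\<lambda>h. integral {x..x + h} g /\<^sub>R h) \<longlongrightarrow> g x) (at_right 0)"
      unfolding tendsto_iff eventually_at_right_field
      using N(2)[OF \<open>x \<notin> N\<close>] by (fastforce simp: dist_norm)
  qed
qed

text \<open>The missing left-hand limit is the right-hand one of the reflected function
  \<open>\<lambda>t. g0 (- t)\<close>.\<close>

lemma AE_has_vector_derivative_indefinite_integral:
  fixes g :: "real \<Rightarrow> 'a::euclidean_space"
  assumes g: "g integrable_on {a..b}"
  shows "AE t in lebesgue_on {a..b}.
           ((\<lambda>t. integral {a..t} g) has_vector_derivative g t) (at t within {a..b})"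
proof -
  \<comment> \<open>Extension by zero, because the one-sided result asks for integrability on every
    interval.\<close>
  define g0 where "g0 = (\<lambda>t. if t \<in> {a..b} then g t else 0)"
  have "g0 integrable_on UNIV"
    unfolding g0_def using g by (simp only: integrable_restrict_UNIV)
  then have g0: "g0 integrable_on {c..d}" for c d
    using integrable_on_subcbox[of g0 UNIV c d] by simp
  have g0': "(\<lambda>t. g0 (- t)) integrable_on {c..d}" for c d
    using g0[of "-d" "-c"] Henstock_Kurzweil_Integration.integrable_reflect_real[where f = g0 and b = "-c" and a = "-d"] by simp
  obtain N where N: "negligible N"
    "\<And>x. x \<notin> N \<Longrightarrow> ((\<lambda>h. integral {x..x + h} g0 /\<^sub>R h) \<longlongrightarrow> g0 x) (at_right 0)"
    using AE_right_derivative_indefinite_integral[OF g0] by blast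
  obtain N' where N': "negligible N'"
    "\<And>x. x \<notin> N' \<Longrightarrow> ((\<lambda>h. integral {x..x + h} (\<lambda>t. g0 (- t)) /\<^sub>R h) \<longlongrightarrow> g0 (- x)) (at_right 0)"
    using AE_right_derivative_indefinite_integral[OF g0'] by blast
  \<comment> \<open>The exceptional set of the reflected function has to be reflected back; smooth
    images of null sets are null.\<close>
  have N'': "negligible (uminus ` N')"
    by (rule negligible_differentiable_image_negligible[OF _ N'(1)]) (auto intro: derivative_intros)
  show ?thesis
  proof (rule AE_lebesgue_onI)
    \<comment> \<open>Without the endpoints, \<open>x\<close> has room on both sides inside
      \<open>{a..b}\<close>, and the two one-sided limits combine to a derivative.\<close>
    show "negligible (N \<union> uminus ` N' \<union> {a, b})"
      using N(1) N'' by auto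
    fix x assume x: "x \<in> {a..b}" "x \<notin> N \<union> uminus ` N' \<union> {a, b}"
    have xab: "a < x" "x < b" using x by auto
    define F where "F = (\<lambda>t. integral {a..t} g0)"
    have R: "((\<lambda>h. integral {x..x + h} g0 /\<^sub>R h) \<longlongrightarrow> g0 x) (at_right 0)"
      using N(2) x by auto
    have refl: "integral {-x..-x + h} (\<lambda>t. g0 (- t)) = integral {x - h..x} g0" for h
      using Henstock_Kurzweil_Integration.integral_reflect_real[where f = g0 and b = x and a = "x - h"] by simp
    have "-x \<notin> N'" using x by (metis UnI1 UnI2 image_eqI minus_minus)
    then have "((\<lambda>h. integral {-x..-x + h} (\<lambda>t. g0 (- t)) /\<^sub>R h) \<longlongrightarrow> g0 x) (at_right 0)"
      using N'(2)[of "-x"] by simp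
    then have L: "((\<lambda>h. integral {x - h..x} g0 /\<^sub>R h) \<longlongrightarrow> g0 x) (at_right 0)"
      unfolding refl .
    have split: "integral {c..d} g0 = F d - F c" if "a \<le> c" "c \<le> d" for c d
      using Henstock_Kurzweil_Integration.integral_combine[of a c d g0] g0 that by (simp add: F_def algebra_simps)
    have R': "((\<lambda>h. (F (x + h) - F x) /\<^sub>R h) \<longlongrightarrow> g0 x) (at_right 0)"
      by (rule Lim_transform_eventually[OF R])
        (auto simp: eventually_at_right_field split xab(1) less_imp_le intro!: exI[of _ 1])
    have L': "((\<lambda>h. (F x - F (x - h)) /\<^sub>R h) \<longlongrightarrow> g0 x) (at_right 0)"
      by (rule Lim_transform_eventually[OF L])
        (use xab in \<open>auto simp: eventually_at_right_field split less_imp_le intro!: exI[of _ "x - a"]\<close>)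
    have "((\<lambda>h. (F (x + h) - F x) /\<^sub>R h) \<longlongrightarrow> g0 x) (at_left 0)"
      unfolding filterlim_at_left_to_right minus_zero
      by (rule Lim_transform_eventually[OF L'])
        (auto simp: eventually_at_right_field scaleR_diff_right intro!: exI[of _ 1])
    with R' have "((\<lambda>h. (F (x + h) - F x) /\<^sub>R h) \<longlongrightarrow> g0 x) (at 0)"
      by (rule filterlim_split_at_real[rotated])
    then have "(F has_vector_derivative g0 x) (at x)"
      by (subst has_vector_derivative_iff_difference_quotient, subst Lim_at_zero) simp
    then have D: "(F has_vector_derivative g0 x) (at x within {a..b})"
      by (rule has_vector_derivative_at_within)
    have eq: "F t = integral {a..t} g" if "t \<in> {a..b}" for t
      unfolding F_def by (rule integral_cong) (use that in \<open>auto simp: g0_def\<close>)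
    have "g0 x = g x" using x by (simp add: g0_def)
    then show "((\<lambda>t. integral {a..t} g) has_vector_derivative g x) (at x within {a..b})"
      using has_vector_derivative_transform[OF x(1) eq[symmetric] D] by simp
  qed simp
qed

text \<open>The difference quotients with step \<open>h n\<close> are bounded by \<open>L\<close>
  and converge a.e. to \<open>g\<close>, so dominated convergence applies. Their integrals collapse
  to a difference of two averages over intervals of length \<open>h n\<close> at \<open>b\<close>
  and at \<open>a\<close>, and these tend to the values of \<open>x\<close> there.\<close>

lemma lipschitz_has_integral_derivative:
  fixes x g :: "real \<Rightarrow> 'a::euclidean_space"
  assumes ab: "a \<le> b" and lip: "L-lipschitz_on {a..b} x"
    and der: "AE t in lebesgue_on {a..b}. (x has_vector_derivative g t) (at t within {a..b})"
  shows "(g has_integral x b - x a) {a..b}"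
proof -
  obtain N where N: "negligible N"
    "\<And>t. t \<in> {a..b} \<Longrightarrow> t \<notin> N \<Longrightarrow> (x has_vector_derivative g t) (at t within {a..b})"
    using AE_lebesgue_onE[OF der] by auto
  \<comment> \<open>At \<open>b\<close> every forward quotient leaves the interval, so this point
    joins the null set.\<close>
  define N0 where "N0 = insert b N"
  have N0: "negligible N0" using N(1) by (simp add: N0_def)
  \<comment> \<open>Clamping the argument extends \<open>x\<close> to the whole line with the same
    Lipschitz constant, so that shifts beyond \<open>b\<close> make sense.\<close>
  define y where "y = (\<lambda>t. x (max a (min b t)))"
  have lipy: "norm (y s - y t) \<le> L * \<bar>s - t\<bar>" for s t
  proof -
    have "norm (y s - y t) \<le> L * \<bar>max a (min b s) - max a (min b t)\<bar>"
      unfolding y_def using lipschitz_onD[OF lip, of "max a (min b s)" "max a (min b t)"] ab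
      by (simp add: dist_norm)
    also have "\<dots> \<le> L * \<bar>s - t\<bar>"
      using lipschitz_on_nonneg[OF lip] by (intro mult_left_mono) auto
    finally show ?thesis .
  qed
  have "L-lipschitz_on UNIV y"
    by (rule lipschitz_onI) (use lipy lipschitz_on_nonneg[OF lip] in \<open>auto simp: dist_norm\<close>)
  then have cont: "continuous_on S y" for S
    using continuous_on_subset[OF lipschitz_on_continuous_on] by blast
  then have int: "y integrable_on {c..d}" for c d
    by (rule integrable_continuous_real)
  define h where "h = (\<lambda>n. inverse (real (Suc n)))"
  have h: "0 < h n" "h n \<noteq> 0" for n by (auto simp: h_def)
  have h0: "h \<longlonglongrightarrow> 0" unfolding h_def by (rule LIMSEQ_inverse_real_of_nat)
  define q where "q = (\<lambda>n t. (y (t + h n) - y t) /\<^sub>R h n)"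
  have shift: "((\<lambda>t. y (t + h n)) has_integral integral {a + h n..b + h n} y) {a..b}" for n
    using has_integral_shift_real_ivl[OF integrable_integral[OF int[of "a + h n" "b + h n"]], of "h n"] by simp
  have q_int: "(q n has_integral
      (integral {b..b + h n} y - integral {a..a + h n} y) /\<^sub>R h n) {a..b}" for n
  proof -
    have "integral {a + h n..b + h n} y - integral {a..b} y
        = integral {b..b + h n} y - integral {a..a + h n} y"
    proof -
      have "integral {a..a + h n} y + integral {a + h n..b + h n} y = integral {a..b + h n} y"
        using ab h(1)[of n] int by (intro Henstock_Kurzweil_Integration.integral_combine) auto
      moreover have "integral {a..b} y + integral {b..b + h n} y = integral {a..b + h n} y"
        using ab h(1)[of n] int by (intro Henstock_Kurzweil_Integration.integral_combine) auto
      ultimately show ?thesis by (simp add: algebra_simps)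
    qed
    then show ?thesis
      unfolding q_def
      using has_integral_cmul[OF has_integral_diff[OF shift[of n] integrable_integral[OF int]], of "inverse (h n)"] by simp
  qed
  have avg: "(\<lambda>n. integral {c..c + h n} y /\<^sub>R h n) \<longlonglongrightarrow> y c" for c
  proof (rule LIM_zero_cancel, rule Lim_null_comparison)
    show "(\<lambda>n. L * h n) \<longlonglongrightarrow> 0" using tendsto_mult_right_zero[OF h0] .
    have "norm (integral {c..c + h n} y /\<^sub>R h n - y c) \<le> L * h n" for n
    proof -
      have "norm (integral {c..c + h n} (\<lambda>t. y t - y c)) \<le> integral {c..c + h n} (\<lambda>t. L * h n)"
      proof (rule integral_norm_bound_integral)
        fix t assume t: "t \<in> {c..c + h n}"
        have "norm (y t - y c) \<le> L * \<bar>t - c\<bar>" by (rule lipy)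
        also have "\<dots> \<le> L * h n" using t lipschitz_on_nonneg[OF lip] by (intro mult_left_mono) auto
        finally show "norm (y t - y c) \<le> L * h n" .
      qed (auto intro!: integrable_diff int)
      moreover have "integral {c..c + h n} (\<lambda>t. y t - y c) = integral {c..c + h n} y - h n *\<^sub>R y c"
        using h(1)[of n] by (subst integral_diff) (auto intro!: int)
      ultimately have "norm (integral {c..c + h n} y - h n *\<^sub>R y c) \<le> L * h n * h n"
        using h(1)[of n] by (simp add: algebra_simps)
      moreover have "integral {c..c + h n} y /\<^sub>R h n - y c = (integral {c..c + h n} y - h n *\<^sub>R y c) /\<^sub>R h n"
        using h(2)[of n] by (simp add: scaleR_diff_right)
      ultimately show ?thesis
        using h(1)[of n] by (simp add: pos_divide_le_eq flip: divide_inverse_commute)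
    qed
    then show "\<forall>\<^sub>F n in sequentially. norm (integral {c..c + h n} y /\<^sub>R h n - y c) \<le> L * h n" by simp
  qed
  \<comment> \<open>The dominated convergence theorem used here asks for convergence at every point
    of the interval; setting quotients and limit to zero on \<open>N0\<close> provides it.\<close>
  define q0 where "q0 = (\<lambda>n t. if t \<in> N0 then 0 else q n t)"
  define g0 where "g0 = (\<lambda>t. if t \<in> N0 then 0 else g t)"
  have q0_int: "(q0 n has_integral
      (integral {b..b + h n} y - integral {a..a + h n} y) /\<^sub>R h n) {a..b}" for n
    by (rule has_integral_spike[OF N0 _ q_int]) (simp add: q0_def)
  have bnd: "norm (q0 n t) \<le> L" for n t
  proof -
    have "norm (q n t) \<le> (L * h n) / h n"
      unfolding q_def using lipy[of "t + h n" t] h(1)[of n] by (simp add: divide_inverse mult.commute mult_right_mono)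
    then show ?thesis
      using h(2)[of n] lipschitz_on_nonneg[OF lip] by (simp add: q0_def)
  qed
  have conv: "(\<lambda>n. q0 n t) \<longlonglongrightarrow> g0 t" if t: "t \<in> {a..b}" for t
  proof (cases "t \<in> N0")
    case False
    then have tb: "t < b" "a \<le> t" and "(x has_vector_derivative g t) (at t within {a..b})"
      using t N(2) by (auto simp: N0_def)
    then have lim: "((\<lambda>s. (x s - x t) /\<^sub>R (s - t)) \<longlongrightarrow> g t) (at t within {a..b})"
      by (simp add: has_vector_derivative_iff_difference_quotient)
    have ev: "\<forall>\<^sub>F n in sequentially. h n < b - t"
      using order_tendstoD(2)[OF h0, of "b - t"] tb by simp
    have "filterlim (\<lambda>n. t + h n) (at t within {a..b}) sequentially"
      unfolding filterlim_at
    proof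
      show "\<forall>\<^sub>F n in sequentially. t + h n \<in> {a..b} \<and> t + h n \<noteq> t"
        using ev by eventually_elim (use tb h in \<open>auto intro: add_increasing2 less_imp_le\<close>)
      show "(\<lambda>n. t + h n) \<longlonglongrightarrow> t" using tendsto_add[OF tendsto_const h0, of t] by simp
    qed
    from filterlim_compose[OF lim this]
    have "(\<lambda>n. (x (t + h n) - x t) /\<^sub>R h n) \<longlonglongrightarrow> g t" by simp
    then have "(\<lambda>n. q n t) \<longlonglongrightarrow> g t"
    proof (rule Lim_transform_eventually)
      show "\<forall>\<^sub>F n in sequentially. (x (t + h n) - x t) /\<^sub>R h n = q n t"
        using ev
      proof eventually_elim
        case (elim n)
        then show ?case using tb h(1)[of n] by (simp add: q_def y_def)
      qed
    qed
    then show ?thesis using False by (simp add: q0_def g0_def)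
  qed (simp add: q0_def g0_def)
  have "g0 integrable_on {a..b}" "(\<lambda>n. integral {a..b} (q0 n)) \<longlonglongrightarrow> integral {a..b} g0"
    using dominated_convergence[of q0 "{a..b}" "\<lambda>_. L" g0] q0_int bnd conv
    by (auto simp: integrable_on_def[symmetric] has_integral_integrable)
  moreover have "(\<lambda>n. integral {a..b} (q0 n)) \<longlonglongrightarrow> y b - y a"
    using tendsto_diff[OF avg avg, of b a] integral_unique[OF q0_int] by (simp add: scaleR_diff_right)
  ultimately have "(g0 has_integral y b - y a) {a..b}"
    using LIMSEQ_unique by (metis integrable_integral)
  then have "(g has_integral y b - y a) {a..b}"
    by (rule has_integral_spike[OF N0, rotated]) (simp add: g0_def)
  then show ?thesis using ab by (simp add: y_def)
qed

text \<open>The right-hand side \<open>e + K * integral {0..t} \<phi>\<close> has derivative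
  \<open>K * \<phi> t\<close>, at most \<open>K\<close> times itself. Multiplied by
  \<open>exp (- (K * t))\<close> it is therefore nonincreasing, and it starts at
  \<open>e\<close>.\<close>

lemma gronwall_integral_inequality:
  fixes \<phi> :: "real \<Rightarrow> real"
  assumes cont: "continuous_on {0..T} \<phi>" and K: "K \<ge> 0"
    and le: "\<And>t. t \<in> {0..T} \<Longrightarrow> \<phi> t \<le> e + K * integral {0..t} \<phi>"
    and t: "t \<in> {0..T}"
  shows "\<phi> t \<le> e * exp (K * t)"
proof -
  define H where "H = (\<lambda>s. exp (- (K * s)) * (e + K * integral {0..s} \<phi>))"
  have dH: "(H has_real_derivative exp (- (K * s)) * K * (\<phi> s - (e + K * integral {0..s} \<phi>))) (at s within {0..T})"
    if s: "s \<in> {0..T}" for s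
  proof -
    have "((\<lambda>u. integral {0..u} \<phi>) has_real_derivative \<phi> s) (at s within {0..T})"
      using integral_has_vector_derivative[OF cont s] by (simp add: has_real_derivative_iff_has_vector_derivative)
    note [derivative_intros] = this
    show ?thesis unfolding H_def
      by (auto intro!: derivative_eq_intros simp: algebra_simps)
  qed
  have "H t \<le> H 0"
  proof (rule DERIV_nonpos_imp_decreasing_open[where f = H])
    show "0 \<le> t" using t by simp
    fix s assume s: "0 < s" "s < t"
    then have "at s within {0..T} = at s" using t by (intro at_within_Icc_at) auto
    then have "(H has_real_derivative exp (- (K * s)) * K * (\<phi> s - (e + K * integral {0..s} \<phi>))) (at s)"
      using dH[of s] s t by simp
    moreover have "exp (- (K * s)) * K * (\<phi> s - (e + K * integral {0..s} \<phi>)) \<le> 0"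
      using le[of s] s t K by (intro mult_nonneg_nonpos) auto
    ultimately show "\<exists>y. DERIV H s :> y \<and> y \<le> 0" by blast
  next
    have "continuous_on {0..T} H"
      by (rule DERIV_continuous_on[OF dH])
    then show "continuous_on {0..t} H" by (rule continuous_on_subset) (use t in auto)
  qed
  then have "exp (- (K * t)) * (e + K * integral {0..t} \<phi>) \<le> e"
    by (simp add: H_def)
  then have "e + K * integral {0..t} \<phi> \<le> e * exp (K * t)"
    by (simp add: exp_minus field_simps)
  then show ?thesis using le[OF t] by linarith
qed

subsection \<open>Caratheodory differential equations\<close>

lemma integrable_lebesgue_on_bounded:
  fixes g :: "real \<Rightarrow> 'a::euclidean_space"
  assumes "g \<in> borel_measurable (lebesgue_on {a..b})" "AE t in lebesgue_on {a..b}. norm (g t) \<le> K"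
  shows "integrable (lebesgue_on {a..b}) g"
proof -
  interpret finite_measure "lebesgue_on {a..b}" by (rule finite_measure_lebesgue_on_Icc)
  show ?thesis by (rule integrable_const_bound[OF assms(2,1)])
qed

text \<open>Simple functions approximating \<open>g\<close> reduce the claim to finitely many fixed second arguments at a time.\<close>

lemma caratheodory_composition_measurable:
  fixes F :: "real \<Rightarrow> 'a::euclidean_space \<Rightarrow> 'b::euclidean_space"
  assumes S: "S \<in> sets lebesgue"
    and F: "\<And>z. (\<lambda>t. F t z) \<in> borel_measurable (lebesgue_on S)"
    and cont: "AE t in lebesgue_on S. continuous_on UNIV (F t)"
    and g: "g \<in> borel_measurable (lebesgue_on S)"
  shows "(\<lambda>t. F t (g t)) \<in> borel_measurable (lebesgue_on S)"
proof -
  obtain N where N: "negligible N" "\<And>t. t \<in> S \<Longrightarrow> t \<notin> N \<Longrightarrow> continuous_on UNIV (F t)"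
    using AE_lebesgue_onE[OF cont S] by blast
  have ind: "(\<lambda>t. indicat_real (- N) t) \<in> borel_measurable (lebesgue_on S)"
    using N(1) by (intro measurable_restrict_space1 borel_measurable_indicator)
      (metis Compl_in_sets_lebesgue negligible_imp_sets)
  \<comment> \<open>The indicator silences the exceptional times, so that the limit below exists at
    every point and not only almost everywhere.\<close>
  define G where "G = (\<lambda>t z. indicat_real (- N) t *\<^sub>R F t z)"
  have G: "(\<lambda>t. G t z) \<in> borel_measurable (lebesgue_on S)" for z
    unfolding G_def using ind F by (rule borel_measurable_scaleR)
  obtain s where s: "\<And>i. simple_function (lebesgue_on S) (s i)"
    "\<And>t. t \<in> space (lebesgue_on S) \<Longrightarrow> (\<lambda>i. s i t) \<longlonglongrightarrow> g t"
    using borel_measurable_implies_sequence_metric[OF g, of 0] by blast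
  have "(\<lambda>t. G t (g t)) \<in> borel_measurable (lebesgue_on S)"
  proof (rule borel_measurable_LIMSEQ_metric)
    fix i
    have "(\<lambda>t. G t (s i t)) = (\<lambda>t. (\<lambda>z t. G t z) (s i t) t)" by simp
    show "(\<lambda>t. G t (s i t)) \<in> borel_measurable (lebesgue_on S)"
      by (rule measurable_compose_countable'[where f = "\<lambda>z t. G t z" and I = "s i ` space (lebesgue_on S)"])
        (use G s(1)[of i] in \<open>auto simp: simple_function_def countable_finite measurable_count_space_eq2\<close>)
  next
    fix t assume t: "t \<in> space (lebesgue_on S)"
    show "(\<lambda>i. G t (s i t)) \<longlonglongrightarrow> G t (g t)"
    proof (cases "t \<in> N")
      case False
      then have "isCont (F t) (g t)"
        using N(2)[of t] t by (simp add: continuous_on_eq_continuous_at)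
      then show ?thesis
        unfolding G_def by (intro tendsto_scaleR tendsto_const isCont_tendsto_compose[of _ "F t"] s(2)[OF t])
    qed (simp add: G_def)
  qed
  then show ?thesis
    by (rule borel_measurable_lebesgue_on_AE[OF _ S])
      (rule AE_lebesgue_onI[OF N(1) _ S], simp add: G_def)
qed

text \<open>The bounds hold at every \<open>t\<close> rather than almost everywhere, which keeps
  null sets out of the fixed point argument; a control is adjusted on a null set to meet them. The
  bound at \<open>0\<close> together with the Lipschitz condition gives linear growth.\<close>

definition caratheodory_lipschitz ::
  "real \<Rightarrow> (real \<Rightarrow> 'a::euclidean_space \<Rightarrow> 'a) \<Rightarrow> real \<Rightarrow> real \<Rightarrow> bool" where
  "caratheodory_lipschitz T F K M \<longleftrightarrow> 0 \<le> T \<and> 0 \<le> K \<and>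
     (\<forall>z. (\<lambda>t. F t z) \<in> borel_measurable (lebesgue_on {0..T})) \<and>
     (\<forall>t\<in>{0..T}. \<forall>y z. norm (F t y - F t z) \<le> K * norm (y - z)) \<and>
     (\<forall>t\<in>{0..T}. norm (F t 0) \<le> M)"

lemma caratheodory_lipschitzD:
  assumes "caratheodory_lipschitz T F K M"
  shows "0 \<le> T" "0 \<le> K" "(\<lambda>t. F t z) \<in> borel_measurable (lebesgue_on {0..T})"
    "t \<in> {0..T} \<Longrightarrow> norm (F t y - F t z) \<le> K * norm (y - z)"
    "t \<in> {0..T} \<Longrightarrow> norm (F t 0) \<le> M" "0 \<le> M"
  using assms order_trans[OF norm_ge_zero, of "F 0 0" M] by (auto simp: caratheodory_lipschitz_def)

lemma caratheodory_lipschitz_norm_le: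
  assumes F: "caratheodory_lipschitz T F K M" and t: "t \<in> {0..T}"
  shows "norm (F t z) \<le> K * norm z + M"
  using caratheodory_lipschitzD(4)[OF F t, of z 0] caratheodory_lipschitzD(5)[OF F t]
    norm_triangle_sub[of "F t z" "F t 0"] by simp

lemma caratheodory_lipschitz_comp_measurable:
  assumes F: "caratheodory_lipschitz T F K M" and x: "x \<in> borel_measurable (lebesgue_on {0..T})"
  shows "(\<lambda>t. F t (x t)) \<in> borel_measurable (lebesgue_on {0..T})"
proof (rule caratheodory_composition_measurable[OF _ caratheodory_lipschitzD(3)[OF F] _ x])
  have "continuous_on UNIV (F t)" if "t \<in> {0..T}" for t
    by (rule lipschitz_on_continuous_on[of K], rule lipschitz_onI) (use caratheodory_lipschitzD[OF F] that in \<open>auto simp: dist_norm\<close>)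
  then show "AE t in lebesgue_on {0..T}. continuous_on UNIV (F t)" by (intro AE_I2) simp
qed simp

lemma caratheodory_lipschitz_comp_integrable:
  assumes F: "caratheodory_lipschitz T F K M" and x: "continuous_on {0..T} x"
  shows "(\<lambda>t. F t (x t)) integrable_on {0..T}"
proof -
  have xm: "x \<in> borel_measurable (lebesgue_on {0..T})"
    using x by (simp add: continuous_imp_measurable_on_sets_lebesgue)
  obtain R where "\<And>t. t \<in> {0..T} \<Longrightarrow> norm (x t) \<le> R"
    using compact_imp_bounded[OF compact_continuous_image[OF x compact_Icc]]
    unfolding bounded_iff by blast
  then have "norm (F t (x t)) \<le> K * R + M" if "t \<in> {0..T}" for t
    using caratheodory_lipschitz_norm_le[OF F that, of "x t"] that
      mult_left_mono[OF _ caratheodory_lipschitzD(2)[OF F], of "norm (x t)" R] by force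
  then have "AE t in lebesgue_on {0..T}. norm (F t (x t)) \<le> K * R + M"
    by (intro AE_I2) simp
  then show ?thesis
    using integrable_lebesgue_on_bounded[OF caratheodory_lipschitz_comp_measurable[OF F xm]] by (intro integrable_on_lebesgue_on) auto
qed

lemma caratheodory_lipschitz_comp_integrable_on:
  assumes F: "caratheodory_lipschitz T F K M" and "continuous_on {0..T} x" "t \<in> {0..T}"
  shows "(\<lambda>s. F s (x s)) integrable_on {0..t}"
  using integrable_on_subinterval[OF caratheodory_lipschitz_comp_integrable[OF assms(1,2)]] assms(3)
  by simp

text \<open>
  Picard iteration for \<open>y t = exp (- l t) x t\<close>, which turns the integral operator into a contraction
  on all of \<open>{0..T}\<close> as soon as \<open>K < l\<close>.
\<close>

lemma integral_solution_exists:
  assumes F: "caratheodory_lipschitz T F K M"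
  obtains x where "continuous_on {0..T} x"
    "\<And>t. t \<in> {0..T} \<Longrightarrow> x t = x0 + integral {0..t} (\<lambda>s. F s (x s))"
proof -
  note T = caratheodory_lipschitzD(1)[OF F] and K = caratheodory_lipschitzD(2)[OF F]
  \<comment> \<open>The contraction factor will be \<open>K / l\<close>; twice \<open>K\<close>
    makes it at most one half, and the added 1 keeps \<open>l\<close> positive for
    \<open>K = 0\<close>.\<close>
  define l where "l = 2 * K + 1"
  have l: "l > 0" using K by (simp add: l_def)
  \<comment> \<open>Banach's theorem is applied in the complete space of bounded continuous
    functions on all of the line. Precomposition with this retraction onto \<open>{0..T}\<close>
    puts the images of the operator there.\<close>
  define c where "c = (\<lambda>t. max 0 (min T t))"
  have c: "c t \<in> {0..T}" "t \<in> {0..T} \<Longrightarrow> c t = t" for t using T by (auto simp: c_def)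
  have cont_c: "continuous_on UNIV c" unfolding c_def by (intro continuous_intros)
  define X where "X = (\<lambda>(y :: real \<Rightarrow>\<^sub>C 'a) t. exp (l * t) *\<^sub>R y t)"
  have contX: "continuous_on S (X y)" for y S
    unfolding X_def by (intro continuous_intros continuous_on_apply_bcontfun)
  define Q where "Q = (\<lambda>y t. exp (- (l * t)) *\<^sub>R (x0 + integral {0..t} (\<lambda>s. F s (X y s))))"
  have contQ: "continuous_on {0..T} (Q y)" for y
    unfolding Q_def
    by (intro continuous_intros indefinite_integral_continuous_1 caratheodory_lipschitz_comp_integrable_on[OF F] contX) (use T in simp)
  have Qbc: "(\<lambda>t. Q y (c t)) \<in> bcontfun" for y
  proof -
    have "continuous_on UNIV (\<lambda>t. Q y (c t))"
      by (rule continuous_on_compose2[OF contQ cont_c]) (use c in auto)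
    moreover have "bounded (range (\<lambda>t. Q y (c t)))"
      by (rule bounded_subset[OF compact_imp_bounded[OF compact_continuous_image[OF contQ compact_Icc]]])
        (use c in auto)
    ultimately show ?thesis by (simp add: bcontfun_def)
  qed
  define P where "P = (\<lambda>y. Bcontfun (\<lambda>t. Q y (c t)))"
  have P: "apply_bcontfun (P y) t = Q y (c t)" for y t
    unfolding P_def using Qbc by (simp add: Bcontfun_inverse)
  have "dist (P y) (P z) \<le> (1/2) * dist y z" for y z
  proof (rule dist_bound)
    fix \<tau>
    define t where "t = c \<tau>"
    have t: "t \<in> {0..T}" using c by (simp add: t_def)
    \<comment> \<open>Integrating the weight \<open>exp (l * s)\<close> gains the factor
      \<open>1 / l\<close>, while the weight itself cancels against
      \<open>exp (- (l * t))\<close>.\<close>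
    have exp_int: "((\<lambda>s. K * dist y z * exp (l * s)) has_integral
        K * dist y z * exp (l * t) / l - K * dist y z * exp (l * 0) / l) {0..t}"
      by (rule fundamental_theorem_of_calculus)
        (use t l in \<open>auto intro!: derivative_eq_intros simp flip: has_real_derivative_iff_has_vector_derivative\<close>)
    have "norm (integral {0..t} (\<lambda>s. F s (X y s) - F s (X z s)))
        \<le> integral {0..t} (\<lambda>s. K * dist y z * exp (l * s))"
    proof (rule integral_norm_bound_integral)
      show "(\<lambda>s. F s (X y s) - F s (X z s)) integrable_on {0..t}"
        by (intro integrable_diff caratheodory_lipschitz_comp_integrable_on[OF F] contX t)
      show "(\<lambda>s. K * dist y z * exp (l * s)) integrable_on {0..t}"
        using exp_int by blast
      fix s assume s: "s \<in> {0..t}"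
      have "norm (F s (X y s) - F s (X z s)) \<le> K * norm (X y s - X z s)"
        by (rule caratheodory_lipschitzD(4)[OF F]) (use s t in auto)
      also have "norm (X y s - X z s) = exp (l * s) * dist (y s) (z s)"
        by (simp add: X_def dist_norm flip: scaleR_diff_right)
      also have "K * \<dots> \<le> K * (exp (l * s) * dist y z)"
        by (intro mult_left_mono K dist_bounded) auto
      finally show "norm (F s (X y s) - F s (X z s)) \<le> K * dist y z * exp (l * s)"
        by (simp add: algebra_simps)
    qed
    also have "\<dots> \<le> K * dist y z * exp (l * t) / l"
      using integral_unique[OF exp_int] K l by simp
    finally have *: "norm (integral {0..t} (\<lambda>s. F s (X y s) - F s (X z s))) \<le> K * dist y z * exp (l * t) / l" .
    have "Q y t - Q z t = exp (- (l * t)) *\<^sub>R integral {0..t} (\<lambda>s. F s (X y s) - F s (X z s))"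
      unfolding Q_def by (simp add: Henstock_Kurzweil_Integration.integral_diff[OF caratheodory_lipschitz_comp_integrable_on[OF F contX t] caratheodory_lipschitz_comp_integrable_on[OF F contX t]]
          flip: scaleR_diff_right)
    then have "norm (Q y t - Q z t) = exp (- (l * t)) * norm (integral {0..t} (\<lambda>s. F s (X y s) - F s (X z s)))"
      by simp
    also have "\<dots> \<le> exp (- (l * t)) * (K * dist y z * exp (l * t) / l)"
      using * by (intro mult_left_mono) auto
    also have "\<dots> = (K / l) * dist y z"
      by (simp add: exp_minus field_simps)
    also have "\<dots> \<le> (1/2) * dist y z"
      using K by (intro mult_right_mono) (auto simp: l_def field_simps)
    finally show "dist (P y \<tau>) (P z \<tau>) \<le> (1/2) * dist y z"
      by (simp add: P dist_norm t_def)
  qed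
  then obtain y where y: "P y = y"
    using banach_fix_type[of "1/2" P] by auto
  show ?thesis
  proof (rule that[of "X y"])
    show "continuous_on {0..T} (X y)" by (rule contX)
    fix t assume t: "t \<in> {0..T}"
    have "y t = Q y t" using P[of y t] y c(2)[OF t] by simp
    then have "X y t = exp (l * t) *\<^sub>R Q y t" by (simp add: X_def)
    then show "X y t = x0 + integral {0..t} (\<lambda>s. F s (X y s))"
      by (simp add: Q_def exp_minus)
  qed
qed

text \<open>Return from the integral equation to the form required by \<open>is_state\<close>. Along
  a continuous, hence bounded, path the integrand is bounded by linear growth, which is the
  Lipschitz constant; the a.e. derivative is Lebesgue differentiation.\<close>

lemma lipschitz_integral_F:
  assumes F: "caratheodory_lipschitz T F K M"
    and x: "continuous_on {0..T} x"
    and eq: "\<And>t. t \<in> {0..T} \<Longrightarrow> x t = x0 + integral {0..t} (\<lambda>s. F s (x s))"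
  shows "\<exists>L. L-lipschitz_on {0..T} x"
    and "AE t in lebesgue_on {0..T}. (x has_vector_derivative F t (x t)) (at t within {0..T})"
proof -
  note T = caratheodory_lipschitzD(1)[OF F] and K = caratheodory_lipschitzD(2)[OF F]
  obtain R where R: "\<And>t. t \<in> {0..T} \<Longrightarrow> norm (x t) \<le> R"
    using compact_imp_bounded[OF compact_continuous_image[OF x compact_Icc]]
    unfolding bounded_iff by blast
  then have "0 \<le> R" using T order_trans[OF norm_ge_zero R[of 0]] by simp
  then have L: "0 \<le> K * R + M" using K caratheodory_lipschitzD(6)[OF F] by simp
  have FR: "norm (F t (x t)) \<le> K * R + M" if "t \<in> {0..T}" for t
    using caratheodory_lipschitz_norm_le[OF F that, of "x t"] mult_left_mono[OF R[OF that] K] by linarith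
  have le: "norm (x t - x s) \<le> (K * R + M) * (t - s)" if "s \<in> {0..T}" "t \<in> {0..T}" "s \<le> t" for s t
  proof -
    have "integral {0..s} (\<lambda>s. F s (x s)) + integral {s..t} (\<lambda>s. F s (x s)) = integral {0..t} (\<lambda>s. F s (x s))"
      using that by (intro Henstock_Kurzweil_Integration.integral_combine caratheodory_lipschitz_comp_integrable_on[OF F] x) auto
    then have "x t - x s = integral {s..t} (\<lambda>s. F s (x s))"
      using eq that by (simp add: algebra_simps)
    moreover have "norm (integral {s..t} (\<lambda>s. F s (x s))) \<le> integral {s..t} (\<lambda>_. K * R + M)"
      by (intro integral_norm_bound_integral integrable_on_subinterval[OF caratheodory_lipschitz_comp_integrable_on[OF F x that(2)]])
        (use that FR in auto)
    ultimately show ?thesis using that by (simp add: mult.commute)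
  qed
  have "(K * R + M)-lipschitz_on {0..T} x"
  proof (rule lipschitz_onI[OF _ L])
    fix s t assume "s \<in> {0..T}" "t \<in> {0..T}"
    then show "dist (x s) (x t) \<le> (K * R + M) * dist s t"
      using le[of s t] le[of t s] by (cases "s \<le> t") (auto simp: dist_norm norm_minus_commute)
  qed
  then show "\<exists>L. L-lipschitz_on {0..T} x" ..
  have T': "T \<in> {0..T}" using T by simp
  have "AE t in lebesgue_on {0..T}. ((\<lambda>t. integral {0..t} (\<lambda>s. F s (x s))) has_vector_derivative F t (x t)) (at t within {0..T})"
    by (rule AE_has_vector_derivative_indefinite_integral[OF caratheodory_lipschitz_comp_integrable_on[OF F x T']])
  moreover have "AE t in lebesgue_on {0..T}. t \<in> {0..T}"
    by (rule AE_I2) simp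
  ultimately show "AE t in lebesgue_on {0..T}. (x has_vector_derivative F t (x t)) (at t within {0..T})"
  proof eventually_elim
    case (elim t)
    have "((\<lambda>t. x0 + integral {0..t} (\<lambda>s. F s (x s))) has_vector_derivative F t (x t)) (at t within {0..T})"
      using elim(1) by (auto intro!: derivative_eq_intros)
    then show ?case
      by (rule has_vector_derivative_transform[OF elim(2), rotated]) (use eq in auto)
  qed
qed

subsection \<open>Nested midpoint convex sets of bounded functions\<close>

lemma (in finite_measure) integrable_power2_bounded:
  fixes u :: "'a \<Rightarrow> 'b::euclidean_space"
  assumes "u \<in> borel_measurable M" "AE t in M. norm (u t) \<le> R"
  shows "integrable M (\<lambda>t. (norm (u t))\<^sup>2)"
proof (rule integrable_const_bound)
  show "AE t in M. norm ((norm (u t))\<^sup>2) \<le> R\<^sup>2"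
    using assms(2) by eventually_elim (simp add: power_mono)
qed (use assms(1) in measurable)

text \<open>Sum and integral of nonnegative functions commute, so the series of increments has
  finite integral and converges absolutely almost everywhere; its partial sums telescope to
  \<open>w n t - w 0 t\<close>.\<close>

lemma AE_convergent_of_summable_L1:
  fixes w :: "nat \<Rightarrow> 'a \<Rightarrow> 'b::euclidean_space"
  assumes w: "\<And>n. integrable M (\<lambda>t. norm (w (Suc n) t - w n t))"
    and meas: "\<And>n. w n \<in> borel_measurable M"
    and sum: "summable (\<lambda>n. \<integral>t. norm (w (Suc n) t - w n t) \<partial>M)"
  obtains u where "u \<in> borel_measurable M" "AE t in M. (\<lambda>n. w n t) \<longlonglongrightarrow> u t"
proof -
  note [measurable] = meas
  have "(\<integral>\<^sup>+t. (\<Sum>n. ennreal (norm (w (Suc n) t - w n t))) \<partial>M)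
      = (\<Sum>n. \<integral>\<^sup>+t. ennreal (norm (w (Suc n) t - w n t)) \<partial>M)"
    by (rule nn_integral_suminf) measurable
  also have "\<dots> = (\<Sum>n. ennreal (\<integral>t. norm (w (Suc n) t - w n t) \<partial>M))"
    by (simp add: nn_integral_eq_integral[OF w])
  also have "\<dots> \<noteq> \<infinity>"
    using sum by (simp add: suminf_ennreal2 Bochner_Integration.integral_nonneg)
  finally have "AE t in M. (\<Sum>n. ennreal (norm (w (Suc n) t - w n t))) \<noteq> \<infinity>"
    by (intro nn_integral_noteq_infinite) measurable
  then have conv: "AE t in M. convergent (\<lambda>n. w n t)"
  proof eventually_elim
    case (elim t)
    then have "summable (\<lambda>n. norm (w (Suc n) t - w n t))"
      by (intro summable_suminf_not_top) auto
    then have "summable (\<lambda>n. w (Suc n) t - w n t)" by (rule summable_norm_cancel)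
    then have "convergent (\<lambda>n. \<Sum>i<n. w (Suc i) t - w i t)"
      by (simp add: summable_iff_convergent)
    then have "convergent (\<lambda>n. w n t - w 0 t)" by (simp add: sum_lessThan_telescope[of "\<lambda>n. w n t"])
    then show ?case by (simp add: convergent_diff_const_right_iff)
  qed
  show ?thesis
  proof (rule that)
    show "(\<lambda>t. lim (\<lambda>n. w n t)) \<in> borel_measurable M" by measurable
    show "AE t in M. (\<lambda>n. w n t) \<longlonglongrightarrow> lim (\<lambda>n. w n t)"
      using conv by eventually_elim (simp add: convergent_LIMSEQ_iff)
  qed
qed

text \<open>
  A substitute for weak compactness: almost minimal \<open>L\<^sup>2\<close> norms and the parallelogram law make a
  diagonal sequence of the nested sets Cauchy.
\<close>

lemma (in finite_measure) nested_midconvex_sequence_converges: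
  fixes S :: "nat \<Rightarrow> ('a \<Rightarrow> 'b::euclidean_space) set"
  assumes meas: "\<And>k u. u \<in> S k \<Longrightarrow> u \<in> borel_measurable M"
    and bnd: "\<And>k u. u \<in> S k \<Longrightarrow> AE t in M. norm (u t) \<le> R"
    and ne: "\<And>k. S k \<noteq> {}" and dec: "decseq S"
    and mid: "\<And>k u v. u \<in> S k \<Longrightarrow> v \<in> S k \<Longrightarrow> (\<lambda>t. (1/2) *\<^sub>R u t + (1/2) *\<^sub>R v t) \<in> S k"
  obtains w u where "\<And>k. w k \<in> S k" "u \<in> borel_measurable M" "AE t in M. (\<lambda>k. w k t) \<longlonglongrightarrow> u t"
proof -
  define N where "N u = (\<integral>t. (norm (u t))\<^sup>2 \<partial>M)" for u :: "'a \<Rightarrow> 'b"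
  have sq: "integrable M (\<lambda>t. (norm (u t))\<^sup>2)" if "u \<in> S k" for u k
    using integrable_power2_bounded meas bnd that by blast
  define R' where "R' = R\<^sup>2 * measure M (space M)"
  have N_le: "N u \<le> R'" if "u \<in> S k" for u k
  proof -
    have "N u \<le> (\<integral>t. R\<^sup>2 \<partial>M)" unfolding N_def
    proof (rule integral_mono_AE)
      show "AE t in M. (norm (u t))\<^sup>2 \<le> R\<^sup>2"
        using bnd[OF that] by eventually_elim (simp add: power_mono)
    qed (use sq[OF that] in auto)
    then show ?thesis by (simp add: R'_def mult.commute)
  qed
  have N_nonneg: "0 \<le> N u" for u unfolding N_def by simp
  \<comment> \<open>Minimal squared norms; they increase because the sets shrink.\<close>
  define d where "d k = Inf (N ` S k)" for k
  have bdd: "bdd_below (N ` S k)" for k using N_nonneg by (intro bdd_belowI[of _ 0]) auto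
  have d_le: "d k \<le> N u" if "u \<in> S k" for u k
    unfolding d_def using that bdd by (intro cInf_lower) auto
  have d_mono: "incseq d"
    unfolding d_def incseq_def
    using decseqD[OF dec] ne bdd by (auto intro!: cInf_superset_mono)
  have d_R: "d k \<le> R'" for k using ne[of k] d_le N_le by (meson ex_in_conv order_trans)
  obtain D where D: "d \<longlonglongrightarrow> D" "\<And>k. d k \<le> D"
    using incseq_convergent[OF d_mono, of R'] d_R by metis
  \<comment> \<open>The parallelogram law will bound the squared distance of consecutive elements by
    \<open>8 * \<epsilon> j\<close>, here exactly \<open>(1/4) ^ j\<close>.\<close>
  define \<epsilon> :: "nat \<Rightarrow> real" where "\<epsilon> j = (1/4) ^ j / 8" for j
  have \<epsilon>: "\<epsilon> j > 0" "\<epsilon> (Suc j) \<le> \<epsilon> j" for j by (auto simp: \<epsilon>_def)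
  \<comment> \<open>Two requirements on the set: far enough along for its minimum to be within
    \<open>\<epsilon> j\<close> of the limit \<open>D\<close>, and index at least \<open>j\<close>,
    so that nestedness puts the chosen element into \<open>S j\<close>.\<close>
  have "\<exists>k\<ge>j. \<exists>u\<in>S k. d k > D - \<epsilon> j \<and> N u < D + \<epsilon> j" for j
  proof -
    have "\<forall>\<^sub>F k in sequentially. d k > D - \<epsilon> j"
      using order_tendstoD(1)[OF D(1), of "D - \<epsilon> j"] \<epsilon>(1)[of j] by simp
    then obtain k0 where "\<And>k. k \<ge> k0 \<Longrightarrow> d k > D - \<epsilon> j"
      by (auto simp: eventually_sequentially)
    then have k: "d (max j k0) > D - \<epsilon> j" by simp
    have "d (max j k0) < D + \<epsilon> j" using D(2)[of "max j k0"] \<epsilon>(1)[of j] by linarith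
    then obtain u where "u \<in> S (max j k0)" "N u < D + \<epsilon> j"
      unfolding d_def using ne[of "max j k0"] bdd by (subst (asm) cInf_less_iff) auto
    then show ?thesis using k by (intro exI[of _ "max j k0"]) auto
  qed
  then obtain k w where kw: "\<And>j. k j \<ge> j" "\<And>j. w j \<in> S (k j)" "\<And>j. d (k j) > D - \<epsilon> j" "\<And>j. N (w j) < D + \<epsilon> j"
    by metis
  have wS: "w j \<in> S j" for j
    using decseqD[OF dec kw(1)[of j]] kw(2)[of j] by auto
  have N_diff: "N (\<lambda>t. w (Suc j) t - w j t) \<le> (1/4) ^ j" for j
  proof -
    \<comment> \<open>The indices \<open>k j\<close> need not increase. The smaller of two
      consecutive ones gives a set containing both elements, hence their midpoint, whose norm
      \<open>d i\<close> bounds from below.\<close>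
    define i where "i = min (k (Suc j)) (k j)"
    have "w (Suc j) \<in> S i" "w j \<in> S i"
      using kw(2) decseqD[OF dec, of i "k (Suc j)"] decseqD[OF dec, of i "k j"] by (auto simp: i_def)
    then have m: "(\<lambda>t. (1/2) *\<^sub>R w (Suc j) t + (1/2) *\<^sub>R w j t) \<in> S i" by (rule mid)
    have "d i > D - \<epsilon> j"
      using kw(3)[of j] kw(3)[of "Suc j"] \<epsilon>(2)[of j] by (auto simp: i_def min_def)
    then have Nm: "N (\<lambda>t. (1/2) *\<^sub>R w (Suc j) t + (1/2) *\<^sub>R w j t) > D - \<epsilon> j"
      using d_le[OF m] by linarith
    have par: "(norm (x - y))\<^sup>2 = 2 * (norm x)\<^sup>2 + 2 * (norm y)\<^sup>2 - 4 * (norm ((1/2) *\<^sub>R x + (1/2) *\<^sub>R y))\<^sup>2"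
      for x y :: 'b
      by (simp add: power2_norm_eq_inner inner_simps inner_commute field_simps)
    have "N (\<lambda>t. w (Suc j) t - w j t)
        = 2 * N (w (Suc j)) + 2 * N (w j) - 4 * N (\<lambda>t. (1/2) *\<^sub>R w (Suc j) t + (1/2) *\<^sub>R w j t)"
      unfolding N_def par using sq[OF wS[of "Suc j"]] sq[OF wS[of j]] sq[OF m] by simp
    also have "\<dots> \<le> 8 * \<epsilon> j"
      using Nm kw(4)[of j] kw(4)[of "Suc j"] \<epsilon>(2)[of j] by linarith
    finally show ?thesis by (simp add: \<epsilon>_def)
  qed
  have diff_meas: "(\<lambda>t. w (Suc j) t - w j t) \<in> borel_measurable M" for j
    using meas[OF wS] by (intro borel_measurable_diff)
  have diff_bnd: "AE t in M. norm (w (Suc j) t - w j t) \<le> R + R" for j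
    using bnd[OF wS[of j]] bnd[OF wS[of "Suc j"]]
    by eventually_elim (use norm_triangle_ineq4 in \<open>fastforce intro: order_trans\<close>)
  have diff_int: "integrable M (\<lambda>t. norm (w (Suc j) t - w j t))" for j
    by (rule integrable_const_bound[of _ "R + R"]) (use diff_bnd diff_meas in auto)
  define m where "m = measure M (space M)"
  have "(\<integral>t. norm (w (Suc j) t - w j t) \<partial>M) \<le> (1 + m) * (1/2) ^ j" for j
  proof -
    \<comment> \<open>Passage from L2 to L1: \<open>s \<le> s\<^sup>2 + 1\<close> at
      \<open>s = 2 ^ j * r\<close>. The weight \<open>2 ^ j\<close> leaves \<open>(1/2) ^ j\<close>
      from the squared distance \<open>(1/4) ^ j\<close> and the same from the mass term.\<close>
    have ag: "r \<le> 2 ^ j * r\<^sup>2 + (1/2) ^ j" for r :: real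
    proof -
      have "s \<le> s\<^sup>2 + 1" for s :: real
        using zero_le_power2[of "s - 1/2"] by (simp add: power2_eq_square algebra_simps)
      from this[of "2 ^ j * r"] have "2 ^ j * r \<le> 2 ^ j * (2 ^ j * r\<^sup>2 + (1/2) ^ j)"
        by (simp add: power_mult_distrib power2_eq_square algebra_simps power_one_over)
      then show ?thesis by simp
    qed
    have "(\<integral>t. norm (w (Suc j) t - w j t) \<partial>M)
        \<le> (\<integral>t. 2 ^ j * (norm (w (Suc j) t - w j t))\<^sup>2 + (1/2) ^ j \<partial>M)"
      using integrable_power2_bounded[OF diff_meas diff_bnd, of j] diff_int ag
      by (intro integral_mono) auto
    also have "\<dots> = 2 ^ j * N (\<lambda>t. w (Suc j) t - w j t) + m * (1/2) ^ j"
      using integrable_power2_bounded[OF diff_meas diff_bnd, of j] by (simp add: N_def m_def)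
    also have "\<dots> \<le> 2 ^ j * (1/4) ^ j + m * (1/2) ^ j"
      using N_diff[of j] by simp
    also have "(2::real) ^ j * (1/4) ^ j = (1/2) ^ j" by (simp flip: power_mult_distrib)
    finally show ?thesis by (simp add: algebra_simps)
  qed
  then have le: "norm (\<integral>t. norm (w (Suc j) t - w j t) \<partial>M) \<le> (1 + m) * (1/2) ^ j" for j
    by (simp add: Bochner_Integration.integral_nonneg)
  have "summable (\<lambda>j. (1 + m) * (1/2) ^ j)"
    by (rule summable_mult, rule summable_geometric) simp
  then have "summable (\<lambda>j. \<integral>t. norm (w (Suc j) t - w j t) \<partial>M)"
    by (rule summable_comparison_test') (rule le)
  then obtain u where "u \<in> borel_measurable M" "AE t in M. (\<lambda>n. w n t) \<longlonglongrightarrow> u t"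
    using AE_convergent_of_summable_L1[where w = w, OF diff_int meas[OF wS]] by blast
  with wS show ?thesis by (rule that)
qed

subsection \<open>The controlled linear system\<close>

lemma bounded_bilinear_matrix_vector_mult:
  "bounded_bilinear ((*v) :: real^'n^'m \<Rightarrow> real^'n \<Rightarrow> real^'m)"
proof -
  have "bilinear ((*v) :: real^'n^'m \<Rightarrow> real^'n \<Rightarrow> real^'m)"
    unfolding bilinear_def
    by (auto intro!: linearI simp: matrix_vector_mult_add_rdistrib matrix_vector_right_distrib
        scaleR_matrix_vector_assoc matrix_vector_mult_scaleR)
  then show ?thesis by (simp add: bilinear_conv_bounded_bilinear)
qed

lemma Linf_integrable: "u \<in> Linf T \<Longrightarrow> integrable (lebesgue_on {0..T}) u"
  using integrable_lebesgue_on_bounded by (auto simp: Linf_def)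

lemma Linf_lincomb:
  assumes "u \<in> Linf T" "v \<in> Linf T"
  shows "(\<lambda>t. p *\<^sub>R u t + q *\<^sub>R v t) \<in> Linf T"
proof -
  obtain R S where ae: "AE t in lebesgue_on {0..T}. norm (u t) \<le> R" "AE t in lebesgue_on {0..T}. norm (v t) \<le> S"
    and [measurable]: "u \<in> borel_measurable (lebesgue_on {0..T})" "v \<in> borel_measurable (lebesgue_on {0..T})"
    using assms unfolding Linf_def by auto
  have "AE t in lebesgue_on {0..T}. norm (p *\<^sub>R u t + q *\<^sub>R v t) \<le> \<bar>p\<bar> * R + \<bar>q\<bar> * S"
    using ae
  proof eventually_elim
    case (elim t)
    have "norm (p *\<^sub>R u t + q *\<^sub>R v t) \<le> \<bar>p\<bar> * norm (u t) + \<bar>q\<bar> * norm (v t)"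
      using norm_triangle_ineq[of "p *\<^sub>R u t" "q *\<^sub>R v t"] by simp
    also have "\<dots> \<le> \<bar>p\<bar> * R + \<bar>q\<bar> * S"
      using elim by (intro add_mono mult_left_mono) auto
    finally show ?case .
  qed
  then show ?thesis unfolding Linf_def by auto
qed

lemma Linf_norm_diff_integrable:
  fixes u v :: "real \<Rightarrow> 'a::euclidean_space"
  assumes "u \<in> Linf T" "v \<in> Linf T"
  shows "integrable (lebesgue_on {0..T}) (\<lambda>t. norm (u t - v t))"
  using assms by (intro integrable_norm Bochner_Integration.integrable_diff Linf_integrable)

definition linear_control :: "real \<Rightarrow> (real \<Rightarrow> real^'n^'n) \<Rightarrow> (real \<Rightarrow> real^'m^'n) \<Rightarrow> bool" where
  "linear_control T A B \<longleftrightarrow> T > 0 \<and>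
     A \<in> borel_measurable (lebesgue_on {0..T}) \<and> bounded (A ` {0..T}) \<and>
     B \<in> borel_measurable (lebesgue_on {0..T}) \<and> bounded (B ` {0..T})"

lemma coefficient_bounds:
  fixes A :: "real \<Rightarrow> real^'n^'n" and B :: "real \<Rightarrow> real^'m^'n"
  assumes lc: "linear_control T A B"
  obtains KA KB where "0 \<le> KA" "0 \<le> KB"
    "\<And>t z. t \<in> {0..T} \<Longrightarrow> norm (A t *v z) \<le> KA * norm z"
    "\<And>t w. t \<in> {0..T} \<Longrightarrow> norm (B t *v w) \<le> KB * norm w"
proof -
  obtain C where C: "C \<ge> 0" "\<And>(M :: real^'n^'n) z. norm (M *v z) \<le> norm M * norm z * C"
    using bounded_bilinear.nonneg_bounded[OF bounded_bilinear_matrix_vector_mult] by metis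
  obtain C' where C': "C' \<ge> 0" "\<And>(M :: real^'m^'n) z. norm (M *v z) \<le> norm M * norm z * C'"
    using bounded_bilinear.nonneg_bounded[OF bounded_bilinear_matrix_vector_mult] by metis
  obtain a b where a: "a > 0" "\<And>t. t \<in> {0..T} \<Longrightarrow> norm (A t) \<le> a"
    and b: "b > 0" "\<And>t. t \<in> {0..T} \<Longrightarrow> norm (B t) \<le> b"
    using lc unfolding linear_control_def bounded_pos by (metis imageI)
  show ?thesis
  proof (rule that[of "a * C" "b * C'"])
    fix t assume t: "t \<in> {0..T}"
    show "norm (A t *v z) \<le> a * C * norm z" for z
    proof -
      have "norm (A t) * (norm z * C) \<le> a * (norm z * C)"
        using a(2)[OF t] C(1) by (intro mult_right_mono) auto
      then show ?thesis using C(2)[of "A t" z] by (simp add: ac_simps)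
    qed
    show "norm (B t *v z) \<le> b * C' * norm z" for z
    proof -
      have "norm (B t) * (norm z * C') \<le> b * (norm z * C')"
        using b(2)[OF t] C'(1) by (intro mult_right_mono) auto
      then show ?thesis using C'(2)[of "B t" z] by (simp add: ac_simps)
    qed
  qed (use a b C C' in auto)
qed

lemma is_state_exists:
  fixes A :: "real \<Rightarrow> real^'n^'n" and B :: "real \<Rightarrow> real^'m^'n"
  assumes lc: "linear_control T A B" and u: "u \<in> Linf T"
  shows "\<exists>x. is_state T x0 A B u x"
proof -
  obtain KA KB where KA: "0 \<le> KA" and KB: "0 \<le> KB"
    and A_le: "\<And>t z. t \<in> {0..T} \<Longrightarrow> norm (A t *v z) \<le> KA * norm z"
    and B_le: "\<And>t w. t \<in> {0..T} \<Longrightarrow> norm (B t *v w) \<le> KB * norm w"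
    by (rule coefficient_bounds[OF lc]) blast
  obtain R where um: "u \<in> borel_measurable (lebesgue_on {0..T})" and R: "AE t in lebesgue_on {0..T}. norm (u t) \<le> R"
    using u by (auto simp: Linf_def)
  \<comment> \<open>The control is bounded only almost everywhere; this version obeys the bound at
    every time and drives the same trajectories. The bound is \<open>\<bar>R\<bar>\<close> because
    no sign of \<open>R\<close> is recorded.\<close>
  define v where "v t = (if norm (u t) \<le> R then u t else 0)" for t
  have vm: "v \<in> borel_measurable (lebesgue_on {0..T})"
    unfolding v_def using um by measurable
  have v_le: "norm (v t) \<le> \<bar>R\<bar>" for t unfolding v_def by auto
  define F where "F t z = A t *v z + B t *v v t" for t z
  have T: "0 \<le> T" using lc by (simp add: linear_control_def)
  have F: "caratheodory_lipschitz T F KA (KB * \<bar>R\<bar>)"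
    unfolding caratheodory_lipschitz_def
  proof (intro conjI allI ballI)
    have bil: "bilinear ((*v) :: real^'k^'l \<Rightarrow> real^'k \<Rightarrow> real^'l)"
      by (simp add: bilinear_conv_bounded_bilinear bounded_bilinear_matrix_vector_mult)
    show "(\<lambda>t. F t z) \<in> borel_measurable (lebesgue_on {0..T})" for z
      unfolding F_def
      by (intro borel_measurable_add borel_measurable_bilinear[OF bil] vm) (use lc in \<open>auto simp: linear_control_def\<close>)
    fix t assume t: "t \<in> {0..T}"
    show "norm (F t y - F t z) \<le> KA * norm (y - z)" for y z
      using A_le[OF t, of "y - z"] by (simp add: F_def matrix_vector_mult_diff_distrib)
    show "norm (F t 0) \<le> KB * \<bar>R\<bar>"
      using B_le[OF t, of "v t"] mult_left_mono[OF v_le KB, of t] by (simp add: F_def)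
  qed (use T KA in auto)
  obtain x where x: "continuous_on {0..T} x"
    "\<And>t. t \<in> {0..T} \<Longrightarrow> x t = x0 + integral {0..t} (\<lambda>s. F s (x s))"
    using integral_solution_exists[OF F, of x0] by metis
  have sol: "\<exists>L. L-lipschitz_on {0..T} x"
    "AE t in lebesgue_on {0..T}. (x has_vector_derivative F t (x t)) (at t within {0..T})"
    by (rule lipschitz_integral_F[OF F, of _ x0]; fact x)+
  have "AE t in lebesgue_on {0..T}. (x has_vector_derivative A t *v x t + B t *v u t) (at t within {0..T})"
    using sol(2) R by eventually_elim (simp add: F_def v_def)
  then have "is_state T x0 A B u x"
    unfolding is_state_def using sol(1) x(2)[of 0] T by simp
  then show ?thesis by blast
qed

text \<open>The difference of two trajectories starts at zero and solves the linear equation driven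
  by \<open>u - v\<close>. Integrating and taking norms gives the hypothesis of Gronwall with
  initial term \<open>KB * e\<close>. The constant precedes the controls, so the estimate gives both
  uniqueness and L1 continuity of the constraint.\<close>

lemma is_state_stable:
  fixes A :: "real \<Rightarrow> real^'n^'n" and B :: "real \<Rightarrow> real^'m^'n"
  assumes lc: "linear_control T A B"
  obtains K where "0 \<le> K"
    "\<And>u v x y t. u \<in> Linf T \<Longrightarrow> v \<in> Linf T \<Longrightarrow> is_state T x0 A B u x \<Longrightarrow> is_state T x0 A B v y \<Longrightarrow>
      t \<in> {0..T} \<Longrightarrow> norm (x t - y t) \<le> K * (LINT s|lebesgue_on {0..T}. norm (u s - v s))"
proof -
  obtain KA KB where KA: "0 \<le> KA" and KB: "0 \<le> KB"
    and A_le: "\<And>t z. t \<in> {0..T} \<Longrightarrow> norm (A t *v z) \<le> KA * norm z"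
    and B_le: "\<And>t w. t \<in> {0..T} \<Longrightarrow> norm (B t *v w) \<le> KB * norm w"
    by (rule coefficient_bounds[OF lc]) blast
  show ?thesis
  proof (rule that[of "KB * exp (KA * T)"])
    fix u v x y t
    assume u: "u \<in> Linf T" and v: "v \<in> Linf T" and x: "is_state T x0 A B u x" and y: "is_state T x0 A B v y"
      and t: "t \<in> {0..T}"
    define e where "e = (LINT s|lebesgue_on {0..T}. norm (u s - v s))"
    have e: "0 \<le> e" by (simp add: e_def)
    have hi: "((\<lambda>s. norm (u s - v s)) has_integral e) {0..T}"
      unfolding e_def by (intro has_integral_integral_lebesgue_on Linf_norm_diff_integrable u v) simp
    obtain L L' where "L-lipschitz_on {0..T} x" "L'-lipschitz_on {0..T} y"
      using x y by (auto simp: is_state_def)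
    then have lip: "(L + L')-lipschitz_on {0..T} (\<lambda>s. x s - y s)" by (rule lipschitz_on_diff)
    have cont: "continuous_on {0..T} (\<lambda>s. norm (x s - y s))"
      by (rule continuous_on_norm[OF lipschitz_on_continuous_on[OF lip]])
    have der: "AE s in lebesgue_on {0..T}. ((\<lambda>s. x s - y s) has_vector_derivative
        A s *v (x s - y s) + B s *v (u s - v s)) (at s within {0..T})"
    proof -
      have "AE s in lebesgue_on {0..T}. (x has_vector_derivative A s *v x s + B s *v u s) (at s within {0..T})"
        "AE s in lebesgue_on {0..T}. (y has_vector_derivative A s *v y s + B s *v v s) (at s within {0..T})"
        using x y by (auto simp: is_state_def)
      then show ?thesis
      proof eventually_elim
        case (elim s)
        show ?case using has_vector_derivative_diff[OF elim]
          by (simp add: matrix_vector_mult_diff_distrib algebra_simps)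
      qed
    qed
    have le: "norm (x r - y r) \<le> KB * e + KA * integral {0..r} (\<lambda>s. norm (x s - y s))" if r: "r \<in> {0..T}" for r
    proof -
      have sub: "{0..r} \<subseteq> {0..T}" using r by auto
      obtain N where N: "negligible N" "\<And>s. s \<in> {0..T} \<Longrightarrow> s \<notin> N \<Longrightarrow> ((\<lambda>s. x s - y s) has_vector_derivative
        A s *v (x s - y s) + B s *v (u s - v s)) (at s within {0..T})"
        using AE_lebesgue_onE[OF der] by auto
      \<comment> \<open>The fundamental theorem is applied on \<open>{0..r}\<close>, so the
        derivative within \<open>{0..T}\<close> is weakened to the smaller interval, outside the
        same null set.\<close>
      have "((\<lambda>s. x s - y s) has_vector_derivative
        A s *v (x s - y s) + B s *v (u s - v s)) (at s within {0..r})" if "s \<in> {0..r}" "s \<notin> N" for s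
        using has_vector_derivative_within_subset[OF N(2) sub] that sub by blast
      then have "AE s in lebesgue_on {0..r}. ((\<lambda>s. x s - y s) has_vector_derivative
        A s *v (x s - y s) + B s *v (u s - v s)) (at s within {0..r})"
        by (rule AE_lebesgue_onI[OF N(1)]) auto
      then have "((\<lambda>s. A s *v (x s - y s) + B s *v (u s - v s)) has_integral (x r - y r) - (x 0 - y 0)) {0..r}"
        using r by (intro lipschitz_has_integral_derivative[OF _ lipschitz_on_subset[OF lip sub]]) auto
      moreover have "x 0 = y 0" using x y by (simp add: is_state_def)
      ultimately have I: "((\<lambda>s. A s *v (x s - y s) + B s *v (u s - v s)) has_integral (x r - y r)) {0..r}"
        by simp
      have i1: "(\<lambda>s. norm (x s - y s)) integrable_on {0..r}"
        by (rule integrable_continuous_real[OF continuous_on_subset[OF cont sub]])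
      have i2: "(\<lambda>s. norm (u s - v s)) integrable_on {0..r}"
        using hi by (intro integrable_on_subinterval[OF _ sub]) auto
      have i3: "(\<lambda>s. KA * norm (x s - y s)) integrable_on {0..r}" "(\<lambda>s. KB * norm (u s - v s)) integrable_on {0..r}"
        using integrable_cmul[OF i1, of KA] integrable_cmul[OF i2, of KB] by simp_all
      have "norm (integral {0..r} (\<lambda>s. A s *v (x s - y s) + B s *v (u s - v s)))
          \<le> integral {0..r} (\<lambda>s. KA * norm (x s - y s) + KB * norm (u s - v s))"
      proof (rule integral_norm_bound_integral)
        show "(\<lambda>s. A s *v (x s - y s) + B s *v (u s - v s)) integrable_on {0..r}" using I by blast
        show "(\<lambda>s. KA * norm (x s - y s) + KB * norm (u s - v s)) integrable_on {0..r}"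
          by (intro integrable_add i3)
        fix s assume "s \<in> {0..r}"
        then have s: "s \<in> {0..T}" using sub by blast
        show "norm (A s *v (x s - y s) + B s *v (u s - v s)) \<le> KA * norm (x s - y s) + KB * norm (u s - v s)"
          by (intro norm_triangle_le add_mono A_le B_le s)
      qed
      also have "\<dots> = KA * integral {0..r} (\<lambda>s. norm (x s - y s)) + KB * integral {0..r} (\<lambda>s. norm (u s - v s))"
        by (simp add: Henstock_Kurzweil_Integration.integral_add i3)
      also have "\<dots> \<le> KA * integral {0..r} (\<lambda>s. norm (x s - y s)) + KB * e"
      proof -
        have "integral {0..r} (\<lambda>s. norm (u s - v s)) \<le> integral {0..T} (\<lambda>s. norm (u s - v s))"
          using hi i2 sub by (intro integral_subset_le) auto
        then show ?thesis using integral_unique[OF hi] KB by (simp add: mult_left_mono)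
      qed
      finally show ?thesis using integral_unique[OF I] by simp
    qed
    have "norm (x t - y t) \<le> KB * e * exp (KA * t)"
      by (rule gronwall_integral_inequality[OF cont KA le t])
    also have "\<dots> \<le> KB * e * exp (KA * T)"
      using t KA KB e by (intro mult_left_mono) (auto intro: mult_left_mono)
    finally show "norm (x t - y t) \<le> KB * exp (KA * T) * (LINT s|lebesgue_on {0..T}. norm (u s - v s))"
      by (simp add: e_def ac_simps)
  qed (use KB in simp)
qed

lemma is_state_unique:
  assumes lc: "linear_control T A B"
    and "u \<in> Linf T" "is_state T x0 A B u x" "is_state T x0 A B u y" "t \<in> {0..T}"
  shows "x t = y t"
proof -
  obtain K where "\<And>u v x y t. u \<in> Linf T \<Longrightarrow> v \<in> Linf T \<Longrightarrow> is_state T x0 A B u x \<Longrightarrow> is_state T x0 A B v y \<Longrightarrow>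
      t \<in> {0..T} \<Longrightarrow> norm (x t - y t) \<le> K * (LINT s|lebesgue_on {0..T}. norm (u s - v s))"
    by (rule is_state_stable[OF lc, where ?x0.0 = x0]) blast
  from this[OF assms(2,2-5)] show ?thesis by simp
qed

text \<open>Justifies the description in \<open>state\<close>. Restricting any solution to
  \<open>{0..T}\<close> gives an extensional one; two of these agree on \<open>{0..T}\<close> by
  stability and elsewhere by extensionality.\<close>

lemma is_state_state:
  assumes lc: "linear_control T A B" and u: "u \<in> Linf T"
  shows "is_state T x0 A B u (state T x0 A B u)"
proof -
  obtain x where x: "is_state T x0 A B u x" using is_state_exists[OF lc u] ..
  define y where "y = restrict x {0..T}"
  have eq: "y t = x t" if "t \<in> {0..T}" for t using that by (simp add: y_def)
  have "is_state T x0 A B u y"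
    unfolding is_state_def
  proof (intro conjI)
    obtain L where "L-lipschitz_on {0..T} x" using x by (auto simp: is_state_def)
    then have "L-lipschitz_on {0..T} y" by (auto simp: lipschitz_on_def eq)
    then show "\<exists>L. L-lipschitz_on {0..T} y" ..
    show "y 0 = x0" using x lc by (simp add: eq is_state_def linear_control_def)
    have "AE t in lebesgue_on {0..T}. (x has_vector_derivative A t *v x t + B t *v u t) (at t within {0..T})"
      using x by (simp add: is_state_def)
    moreover have "AE t in lebesgue_on {0..T}. t \<in> {0..T}" by (rule AE_I2) simp
    ultimately show "AE t in lebesgue_on {0..T}. (y has_vector_derivative A t *v y t + B t *v u t) (at t within {0..T})"
    proof eventually_elim
      case (elim t)
      show ?case
        using has_vector_derivative_transform[OF elim(2) eq elim(1)] eq[OF elim(2)] by simp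
    qed
  qed
  moreover have "y \<in> extensional {0..T}" by (simp add: y_def)
  moreover have "z = y" if "z \<in> extensional {0..T} \<and> is_state T x0 A B u z" for z
    using that calculation is_state_unique[OF lc u] by (intro extensionalityI[of z "{0..T}" y]) auto
  ultimately have "\<exists>!x. x \<in> extensional {0..T} \<and> is_state T x0 A B u x" by blast
  from theI'[OF this] show ?thesis unfolding state_def by blast
qed

lemma state_continuous:
  assumes lc: "linear_control T A B" and u: "u \<in> Linf T"
  shows "continuous_on {0..T} (state T x0 A B u)"
  using is_state_state[OF lc u] lipschitz_on_continuous_on by (auto simp: is_state_def)

lemma state_measurable:
  assumes lc: "linear_control T A B" and u: "u \<in> Linf T"
  shows "state T x0 A B u \<in> borel_measurable (lebesgue_on {0..T})"
  by (intro continuous_imp_measurable_on_sets_lebesgue state_continuous[OF lc] u) simp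

lemma state_bounded:
  assumes lc: "linear_control T A B" and u: "u \<in> Linf T"
  obtains R where "\<And>t. t \<in> {0..T} \<Longrightarrow> norm (state T x0 A B u t) \<le> R"
  using compact_imp_bounded[OF compact_continuous_image[OF state_continuous[OF lc u] compact_Icc]]
  unfolding bounded_iff by blast

text \<open>The combined trajectory solves the equation for the combined control, and
  \<open>p + q = 1\<close> preserves the initial value \<open>x0\<close>; uniqueness does the rest.
  Signs of the weights do not matter.\<close>

lemma state_affine:
  assumes lc: "linear_control T A B" and u: "u \<in> Linf T" and v: "v \<in> Linf T" and pq: "p + q = 1" and t: "t \<in> {0..T}"
  shows "state T x0 A B (\<lambda>t. p *\<^sub>R u t + q *\<^sub>R v t) t = p *\<^sub>R state T x0 A B u t + q *\<^sub>R state T x0 A B v t"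
proof (rule is_state_unique[OF lc _ is_state_state[OF lc] _ t])
  let ?x = "state T x0 A B u" and ?y = "state T x0 A B v"
  have x: "is_state T x0 A B u ?x" and y: "is_state T x0 A B v ?y" using is_state_state[OF lc] u v by auto
  show "is_state T x0 A B (\<lambda>t. p *\<^sub>R u t + q *\<^sub>R v t) (\<lambda>t. p *\<^sub>R ?x t + q *\<^sub>R ?y t)"
    unfolding is_state_def
  proof (intro conjI)
    obtain L L' where "L-lipschitz_on {0..T} ?x" "L'-lipschitz_on {0..T} ?y"
      using x y by (auto simp: is_state_def)
    then show "\<exists>L. L-lipschitz_on {0..T} (\<lambda>t. p *\<^sub>R ?x t + q *\<^sub>R ?y t)"
      using lipschitz_on_add[OF lipschitz_on_cmult lipschitz_on_cmult] by blast
    show "p *\<^sub>R ?x 0 + q *\<^sub>R ?y 0 = x0"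
      using x y pq by (simp add: is_state_def flip: scaleR_left_distrib)
    have "AE t in lebesgue_on {0..T}. (?x has_vector_derivative A t *v ?x t + B t *v u t) (at t within {0..T})"
      "AE t in lebesgue_on {0..T}. (?y has_vector_derivative A t *v ?y t + B t *v v t) (at t within {0..T})"
      using x y by (auto simp: is_state_def)
    then show "AE t in lebesgue_on {0..T}. ((\<lambda>t. p *\<^sub>R ?x t + q *\<^sub>R ?y t) has_vector_derivative
        A t *v (p *\<^sub>R ?x t + q *\<^sub>R ?y t) + B t *v (p *\<^sub>R u t + q *\<^sub>R v t)) (at t within {0..T})"
    proof eventually_elim
      case (elim t)
      show ?case
        by (rule has_vector_derivative_eq_rhs[OF has_vector_derivative_add[OF
              bounded_linear.has_vector_derivative[OF bounded_linear_scaleR_right elim(1)]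
              bounded_linear.has_vector_derivative[OF bounded_linear_scaleR_right elim(2)]]])
          (simp add: matrix_vector_right_distrib matrix_vector_mult_scaleR scaleR_add_right)
    qed
  qed
qed (intro Linf_lincomb u v)+

subsection \<open>Payoff, constraint and value function\<close>

text \<open>Against each \<open>g\<close> in \<open>L1 T\<close> the pairings are dominated by
  \<open>norm (g t) * R\<close>, hence converge. Limits in the product topology are componentwise,
  and weak-* open sets are preimages of product open sets.\<close>

lemma limitin_weak_star_AE:
  fixes w :: "nat \<Rightarrow> real \<Rightarrow> 'a::euclidean_space"
  assumes w: "\<And>k. w k \<in> Linf T" and u: "u \<in> Linf T"
    and bnd: "\<And>k. AE t in lebesgue_on {0..T}. norm (w k t) \<le> R"
    and lim: "AE t in lebesgue_on {0..T}. (\<lambda>k. w k t) \<longlonglongrightarrow> u t"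
  shows "limitin (weak_star T) w u sequentially"
proof -
  define P where "P = (\<lambda>u :: real \<Rightarrow> 'a. \<lambda>g\<in>L1 T. LINT t|lebesgue_on {0..T}. g t \<bullet> u t)"
  have "(\<lambda>k. LINT t|lebesgue_on {0..T}. g t \<bullet> w k t) \<longlonglongrightarrow> (LINT t|lebesgue_on {0..T}. g t \<bullet> u t)"
    if g: "g \<in> L1 T" for g :: "real \<Rightarrow> 'a"
  proof (rule integral_dominated_convergence[where w = "\<lambda>t. norm (g t) * R"])
    have gi: "integrable (lebesgue_on {0..T}) g" using g by (simp add: L1_def)
    have [measurable]: "g \<in> borel_measurable (lebesgue_on {0..T})" "u \<in> borel_measurable (lebesgue_on {0..T})"
      "\<And>k. w k \<in> borel_measurable (lebesgue_on {0..T})"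
      using gi u w by (auto simp: Linf_def)
    show "(\<lambda>t. g t \<bullet> u t) \<in> borel_measurable (lebesgue_on {0..T})"
      "\<And>k. (\<lambda>t. g t \<bullet> w k t) \<in> borel_measurable (lebesgue_on {0..T})" by measurable
    show "integrable (lebesgue_on {0..T}) (\<lambda>t. norm (g t) * R)" using gi by simp
    show "AE t in lebesgue_on {0..T}. (\<lambda>k. g t \<bullet> w k t) \<longlonglongrightarrow> g t \<bullet> u t"
      using lim by eventually_elim (intro tendsto_intros)
    show "AE t in lebesgue_on {0..T}. norm (g t \<bullet> w k t) \<le> norm (g t) * R" for k
      using bnd[of k]
    proof eventually_elim
      case (elim t)
      have "norm (g t \<bullet> w k t) \<le> norm (g t) * norm (w k t)" by (simp add: Cauchy_Schwarz_ineq2)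
      also have "\<dots> \<le> norm (g t) * R" using elim by (intro mult_left_mono) auto
      finally show ?case .
    qed
  qed
  then have lim: "limitin (powertop_real (L1 T)) (\<lambda>k. P (w k)) (P u) sequentially"
    unfolding limitin_componentwise by (auto simp: P_def)
  have "\<forall>\<^sub>F k in sequentially. w k \<in> V" if V: "openin (weak_star T) V" "u \<in> V" for V
  proof -
    obtain W where W: "openin (powertop_real (L1 T)) W" "V = P -` W \<inter> Linf T"
      using V(1) unfolding weak_star_def openin_pullback_topology P_def by blast
    then have "P u \<in> W" using V(2) by blast
    with lim W(1) have "\<forall>\<^sub>F k in sequentially. P (w k) \<in> W" by (simp add: limitin_def)
    then show ?thesis by eventually_elim (use w W(2) in simp)
  qed
  then show ?thesis using u by (simp add: limitin_def)
qed

text \<open>If \<open>J u < r\<close>, the open set \<open>{J < r}\<close> would contain some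
  \<open>w k\<close>. This is the form in which semicontinuity of the payoff is applied.\<close>

lemma usc_map_limit_ge:
  assumes "usc_map (subtopology X S) J" "limitin X w u sequentially" "u \<in> S"
    and "\<And>k. w k \<in> S" "\<And>k. r \<le> J (w k)"
  shows "r \<le> J u"
proof (rule ccontr)
  assume "\<not> r \<le> J u"
  have "openin (subtopology X S) {x \<in> topspace (subtopology X S). J x < r}"
    using assms(1) by (simp add: usc_map_def)
  then obtain V where V: "openin X V" "{x \<in> topspace (subtopology X S). J x < r} = V \<inter> S"
    by (auto simp: openin_subtopology)
  have "u \<in> topspace X" using assms(2) by (simp add: limitin_def)
  then have "u \<in> {x \<in> topspace (subtopology X S). J x < r}"
    using assms(3) \<open>\<not> r \<le> J u\<close> by (simp add: topspace_subtopology)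
  then have "u \<in> V" unfolding V(2) by simp
  then have "\<forall>\<^sub>F k in sequentially. w k \<in> V" using assms(2) V(1) by (simp add: limitin_def)
  then obtain k where "w k \<in> V" by (auto simp: eventually_sequentially)
  then have "J (w k) < r" using V(2) assms(4)[of k] by blast
  then show False using assms(5)[of k] by simp
qed

section \<open>Admissible controls and concavity of the payoff\<close>

lemma admissible_lincomb:
  assumes "convex U" "u \<in> admissible T U" "v \<in> admissible T U" "0 \<le> p" "0 \<le> q" "p + q = 1"
  shows "(\<lambda>t. p *\<^sub>R u t + q *\<^sub>R v t) \<in> admissible T U"
proof -
  have "AE t in lebesgue_on {0..T}. u t \<in> U" "AE t in lebesgue_on {0..T}. v t \<in> U"
    using assms by (auto simp: admissible_def)
  then have "AE t in lebesgue_on {0..T}. p *\<^sub>R u t + q *\<^sub>R v t \<in> U"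
    by eventually_elim (use assms in \<open>auto intro: convexD\<close>)
  then show ?thesis using Linf_lincomb[of u T v p q] assms by (simp add: admissible_def)
qed

lemma C1_imp_continuous: "C1 F \<Longrightarrow> continuous_on UNIV F"
  unfolding C1_def by (metis UNIV_I continuous_at_imp_continuous_on has_derivative_continuous)

text \<open>Needed before integrals are added or compared, since a nonintegrable function would have
  integral zero by convention. States are bounded and controls lie a.e. in the compact
  \<open>U\<close>, so quadratic growth becomes a constant bound.\<close>

lemma payoff_integrable:
  assumes lc: "linear_control T A B"
    and U: "compact U"
    and f: "\<And>x v. (\<lambda>t. f t (x, v)) \<in> borel_measurable (lebesgue_on {0..T})"
    and cont: "AE t in lebesgue_on {0..T}. continuous_on UNIV (f t)"
    and c: "c \<ge> 0"
    and bnd: "\<And>t x v. t \<in> {0..T} \<Longrightarrow> v \<in> U \<Longrightarrow> \<bar>f t (x, v)\<bar> \<le> c * (1 + (norm x)\<^sup>2 + (norm v)\<^sup>2)"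
    and u: "u \<in> admissible T U"
  shows "integrable (lebesgue_on {0..T}) (\<lambda>t. f t (state T x0 A B u t, u t))"
proof -
  have uL: "u \<in> Linf T" and um: "u \<in> borel_measurable (lebesgue_on {0..T})"
    and uU: "AE t in lebesgue_on {0..T}. u t \<in> U"
    using u by (auto simp: admissible_def Linf_def)
  have g: "(\<lambda>t. (state T x0 A B u t, u t)) \<in> borel_measurable (lebesgue_on {0..T})"
    by (rule borel_measurable_Pair[OF state_measurable[OF lc uL] um])
  have m: "(\<lambda>t. f t (state T x0 A B u t, u t)) \<in> borel_measurable (lebesgue_on {0..T})"
    by (rule caratheodory_composition_measurable[OF _ _ cont g]) (use f in auto)
  obtain R where R: "\<And>t. t \<in> {0..T} \<Longrightarrow> norm (state T x0 A B u t) \<le> R"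
    using state_bounded[OF lc uL] by blast
  obtain K where K: "\<And>v. v \<in> U \<Longrightarrow> norm v \<le> K"
    using compact_imp_bounded[OF U] unfolding bounded_iff by blast
  have "AE t in lebesgue_on {0..T}. t \<in> {0..T}" by (rule AE_I2) simp
  with uU have "AE t in lebesgue_on {0..T}. norm (f t (state T x0 A B u t, u t)) \<le> c * (1 + R\<^sup>2 + K\<^sup>2)"
  proof eventually_elim
    case (elim t)
    have "norm (f t (state T x0 A B u t, u t)) \<le> c * (1 + (norm (state T x0 A B u t))\<^sup>2 + (norm (u t))\<^sup>2)"
      using bnd[OF elim(2,1)] by simp
    also have "\<dots> \<le> c * (1 + R\<^sup>2 + K\<^sup>2)"
      using R[OF elim(2)] K[OF elim(1)] c by (intro mult_left_mono add_mono power_mono) auto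
    finally show ?case .
  qed
  then show ?thesis by (rule integrable_lebesgue_on_bounded[OF m])
qed

text \<open>Because the state is affine in the control, the pair of state and control at the
  combination is the combination of the pairs, where joint concavity of \<open>f t\<close> acts
  pointwise; concavity of \<open>\<phi>\<close> acts at time \<open>T\<close>.\<close>

lemma payoff_concave:
  assumes lc: "linear_control T A B"
    and U: "compact U" "convex U"
    and f: "\<And>x v. (\<lambda>t. f t (x, v)) \<in> borel_measurable (lebesgue_on {0..T})"
    and cont: "AE t in lebesgue_on {0..T}. continuous_on UNIV (f t)"
    and conc: "AE t in lebesgue_on {0..T}. concave_on UNIV (f t)"
    and c: "c \<ge> 0"
    and bnd: "\<And>t x v. t \<in> {0..T} \<Longrightarrow> v \<in> U \<Longrightarrow> \<bar>f t (x, v)\<bar> \<le> c * (1 + (norm x)\<^sup>2 + (norm v)\<^sup>2)"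
    and \<phi>: "concave_on UNIV \<phi>"
    and u: "u \<in> admissible T U" and v: "v \<in> admissible T U" and pq: "0 \<le> p" "0 \<le> q" "p + q = 1"
  shows "p * payoff T x0 A B f \<phi> u + q * payoff T x0 A B f \<phi> v
    \<le> payoff T x0 A B f \<phi> (\<lambda>t. p *\<^sub>R u t + q *\<^sub>R v t)"
proof -
  let ?w = "\<lambda>t. p *\<^sub>R u t + q *\<^sub>R v t"
  let ?x = "state T x0 A B u" and ?y = "state T x0 A B v" and ?z = "state T x0 A B ?w"
  have w: "?w \<in> admissible T U" by (rule admissible_lincomb[OF U(2) u v pq])
  have z: "?z t = p *\<^sub>R ?x t + q *\<^sub>R ?y t" if "t \<in> {0..T}" for t
    using u v pq that by (intro state_affine[OF lc]) (auto simp: admissible_def)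
  have int: "integrable (lebesgue_on {0..T}) (\<lambda>t. f t (state T x0 A B u t, u t))" if "u \<in> admissible T U" for u
    by (rule payoff_integrable[OF lc U(1) f cont c _ that]) (rule bnd)
  have "p * (LINT t|lebesgue_on {0..T}. f t (?x t, u t)) + q * (LINT t|lebesgue_on {0..T}. f t (?y t, v t))
      = (LINT t|lebesgue_on {0..T}. p * f t (?x t, u t) + q * f t (?y t, v t))"
    using int[OF u] int[OF v] by simp
  also have "\<dots> \<le> (LINT t|lebesgue_on {0..T}. f t (?z t, ?w t))"
  proof (rule integral_mono_AE)
    have "AE t in lebesgue_on {0..T}. t \<in> {0..T}" by (rule AE_I2) simp
    with conc show "AE t in lebesgue_on {0..T}. p * f t (?x t, u t) + q * f t (?y t, v t) \<le> f t (?z t, ?w t)"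
    proof eventually_elim
      case (elim t)
      then show ?case
        using concave_on_iff[of UNIV "f t"] pq z[OF elim(2)] by auto
    qed
  qed (use int[OF u] int[OF v] int[OF w] in auto)
  finally have "p * (LINT t|lebesgue_on {0..T}. f t (?x t, u t)) + q * (LINT t|lebesgue_on {0..T}. f t (?y t, v t))
      \<le> (LINT t|lebesgue_on {0..T}. f t (?z t, ?w t))" .
  moreover have "p * \<phi> (?x T) + q * \<phi> (?y T) \<le> \<phi> (?z T)"
    using \<phi> pq z[of T] lc unfolding concave_on_iff linear_control_def by auto
  ultimately show ?thesis by (simp add: payoff_def algebra_simps)
qed

section \<open>Affinity and L1 continuity of the constraint\<close>

lemma inner_bounded_integrable:
  fixes a x :: "real \<Rightarrow> 'k::euclidean_space"
  assumes "a \<in> borel_measurable (lebesgue_on {0..T})" "bounded (a ` {0..T})" and x: "x \<in> Linf T"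
  shows "integrable (lebesgue_on {0..T}) (\<lambda>t. a t \<bullet> x t)"
proof -
  obtain R where xm: "x \<in> borel_measurable (lebesgue_on {0..T})" and R: "AE t in lebesgue_on {0..T}. norm (x t) \<le> R"
    using x by (auto simp: Linf_def)
  obtain K where K: "K > 0" "\<And>t. t \<in> {0..T} \<Longrightarrow> norm (a t) \<le> K"
    using assms(2) unfolding bounded_pos by (metis imageI)
  have "AE t in lebesgue_on {0..T}. t \<in> {0..T}" by (rule AE_I2) simp
  with R have "AE t in lebesgue_on {0..T}. norm (a t \<bullet> x t) \<le> K * R"
  proof eventually_elim
    case (elim t)
    have "norm (a t \<bullet> x t) \<le> norm (a t) * norm (x t)" by (simp add: Cauchy_Schwarz_ineq2)
    also have "\<dots> \<le> K * R" using elim K by (intro mult_mono) auto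
    finally show ?case .
  qed
  then show ?thesis
    by (rule integrable_lebesgue_on_bounded[OF borel_measurable_inner[OF assms(1) xm]])
qed

lemma state_Linf:
  assumes lc: "linear_control T A B" and u: "u \<in> Linf T"
  shows "state T x0 A B u \<in> Linf T"
proof -
  obtain R where "\<And>t. t \<in> {0..T} \<Longrightarrow> norm (state T x0 A B u t) \<le> R"
    using state_bounded[OF lc u] by blast
  then have "AE t in lebesgue_on {0..T}. norm (state T x0 A B u t) \<le> R" by (intro AE_I2) simp
  then show ?thesis unfolding Linf_def using state_measurable[OF lc u] by blast
qed

lemma integrable_lebesgue_on_bounded_image:
  fixes c :: "real \<Rightarrow> 'k::euclidean_space"
  assumes "c \<in> borel_measurable (lebesgue_on {0..T})" "bounded (c ` {0..T})"
  shows "integrable (lebesgue_on {0..T}) c"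
  using assms unfolding bounded_iff by (auto intro!: integrable_lebesgue_on_bounded AE_I2)

lemma constraint_eq:
  assumes lc: "linear_control T A B"
    and a: "a \<in> borel_measurable (lebesgue_on {0..T})" "bounded (a ` {0..T})"
    and b: "b \<in> borel_measurable (lebesgue_on {0..T})" "bounded (b ` {0..T})"
    and c: "c \<in> borel_measurable (lebesgue_on {0..T})" "bounded (c ` {0..T})"
    and u: "u \<in> Linf T"
  shows "constraint T x0 A B a b c u = (LINT t|lebesgue_on {0..T}. a t \<bullet> state T x0 A B u t)
    + (LINT t|lebesgue_on {0..T}. b t \<bullet> u t) + (LINT t|lebesgue_on {0..T}. c t)"
  unfolding constraint_def
  using inner_bounded_integrable[OF a state_Linf[OF lc u]] inner_bounded_integrable[OF b u]
    integrable_lebesgue_on_bounded_image[OF c]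
  by simp

lemma constraint_affine:
  assumes lc: "linear_control T A B"
    and a: "a \<in> borel_measurable (lebesgue_on {0..T})" "bounded (a ` {0..T})"
    and b: "b \<in> borel_measurable (lebesgue_on {0..T})" "bounded (b ` {0..T})"
    and c: "c \<in> borel_measurable (lebesgue_on {0..T})" "bounded (c ` {0..T})"
    and u: "u \<in> Linf T" and v: "v \<in> Linf T" and pq: "p + q = 1"
  shows "constraint T x0 A B a b c (\<lambda>t. p *\<^sub>R u t + q *\<^sub>R v t)
    = p * constraint T x0 A B a b c u + q * constraint T x0 A B a b c v"
proof -
  note au = inner_bounded_integrable[OF a state_Linf[OF lc u]] and av = inner_bounded_integrable[OF a state_Linf[OF lc v]]
    and bu = inner_bounded_integrable[OF b u] and bv = inner_bounded_integrable[OF b v]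
  have "(LINT t|lebesgue_on {0..T}. a t \<bullet> state T x0 A B (\<lambda>t. p *\<^sub>R u t + q *\<^sub>R v t) t)
      = (LINT t|lebesgue_on {0..T}. p * (a t \<bullet> state T x0 A B u t) + q * (a t \<bullet> state T x0 A B v t))"
    by (intro Bochner_Integration.integral_cong) (auto simp: state_affine[OF lc u v pq] inner_add_right)
  moreover have "(LINT t|lebesgue_on {0..T}. b t \<bullet> (p *\<^sub>R u t + q *\<^sub>R v t))
      = (LINT t|lebesgue_on {0..T}. p * (b t \<bullet> u t) + q * (b t \<bullet> v t))"
    by (simp add: inner_add_right)
  \<comment> \<open>The term independent of the control splits only because the weights add up to
    1.\<close>
  moreover have "(LINT t|lebesgue_on {0..T}. c t) = p * (LINT t|lebesgue_on {0..T}. c t) + q * (LINT t|lebesgue_on {0..T}. c t)"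
    using pq by (simp flip: distrib_right)
  ultimately show ?thesis
    using au av bu bv by (simp add: constraint_eq[OF lc a b c u] constraint_eq[OF lc a b c v] constraint_eq[OF lc a b c Linf_lincomb[OF u v]]
        algebra_simps)
qed

lemma constraint_L1_lipschitz:
  fixes b :: "real \<Rightarrow> real^'m"
  assumes lc: "linear_control T A B"
    and a: "a \<in> borel_measurable (lebesgue_on {0..T})" "bounded (a ` {0..T})"
    and b: "b \<in> borel_measurable (lebesgue_on {0..T})" "bounded (b ` {0..T})"
    and c: "c \<in> borel_measurable (lebesgue_on {0..T})" "bounded (c ` {0..T})"
  obtains Q where "\<And>u v. u \<in> Linf T \<Longrightarrow> v \<in> Linf T \<Longrightarrow>
    \<bar>constraint T x0 A B a b c u - constraint T x0 A B a b c v\<bar> \<le> Q * (LINT t|lebesgue_on {0..T}. norm (u t - v t))"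
proof -
  obtain K where K: "0 \<le> K"
    "\<And>u v x y t. u \<in> Linf T \<Longrightarrow> v \<in> Linf T \<Longrightarrow> is_state T x0 A B u x \<Longrightarrow> is_state T x0 A B v y \<Longrightarrow>
      t \<in> {0..T} \<Longrightarrow> norm (x t - y t) \<le> K * (LINT s|lebesgue_on {0..T}. norm (u s - v s))"
    by (rule is_state_stable[OF lc, where ?x0.0 = x0]) blast
  obtain Ka Kb where Ka: "Ka > 0" "\<And>t. t \<in> {0..T} \<Longrightarrow> norm (a t) \<le> Ka"
    and Kb: "Kb > 0" "\<And>t. t \<in> {0..T} \<Longrightarrow> norm (b t) \<le> Kb"
    using a(2) b(2) unfolding bounded_pos by (metis imageI)
  interpret finite_measure "lebesgue_on {0..T}" by (rule finite_measure_lebesgue_on_Icc)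
  define m where "m = measure (lebesgue_on {0..T}) {0..T}"
  show ?thesis
  \<comment> \<open>The state term costs the uniform estimate \<open>K\<close> times
    \<open>Ka\<close>, integrated over an interval of length \<open>m\<close>; the control term
    costs \<open>Kb\<close> directly.\<close>
  proof (rule that[of "m * (Ka * K) + Kb"])
    fix u v :: "real \<Rightarrow> real^'m"
    assume u: "u \<in> Linf T" and v: "v \<in> Linf T"
    define e where "e = (LINT t|lebesgue_on {0..T}. norm (u t - v t))"
    let ?x = "state T x0 A B u" and ?y = "state T x0 A B v"
    have xy: "norm (?x t - ?y t) \<le> K * e" if "t \<in> {0..T}" for t
      unfolding e_def by (rule K(2)[OF u v is_state_state[OF lc u] is_state_state[OF lc v] that])
    note int = inner_bounded_integrable[OF a state_Linf[OF lc u]] inner_bounded_integrable[OF a state_Linf[OF lc v]]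
      inner_bounded_integrable[OF b u] inner_bounded_integrable[OF b v]
    have eq: "constraint T x0 A B a b c u - constraint T x0 A B a b c v
        = (LINT t|lebesgue_on {0..T}. a t \<bullet> (?x t - ?y t) + b t \<bullet> (u t - v t))"
      using int by (simp add: constraint_eq[OF lc a b c] u v inner_diff_right)
    have "\<bar>constraint T x0 A B a b c u - constraint T x0 A B a b c v\<bar>
        \<le> (LINT t|lebesgue_on {0..T}. Ka * (K * e) + Kb * norm (u t - v t))"
      unfolding eq
    proof (rule integral_abs_bound_integral)
      show "integrable (lebesgue_on {0..T}) (\<lambda>t. a t \<bullet> (?x t - ?y t) + b t \<bullet> (u t - v t))"
        using int by (simp add: inner_diff_right)
      show "integrable (lebesgue_on {0..T}) (\<lambda>t. Ka * (K * e) + Kb * norm (u t - v t))"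
        using Linf_norm_diff_integrable[OF u v] by simp
      fix t assume "t \<in> space (lebesgue_on {0..T})"
      then have t: "t \<in> {0..T}" by simp
      have "\<bar>a t \<bullet> (?x t - ?y t)\<bar> \<le> norm (a t) * norm (?x t - ?y t)" by (rule Cauchy_Schwarz_ineq2)
      also have "\<dots> \<le> Ka * (K * e)" using Ka t xy by (intro mult_mono) auto
      finally have 1: "\<bar>a t \<bullet> (?x t - ?y t)\<bar> \<le> Ka * (K * e)" .
      have "\<bar>b t \<bullet> (u t - v t)\<bar> \<le> norm (b t) * norm (u t - v t)" by (rule Cauchy_Schwarz_ineq2)
      also have "\<dots> \<le> Kb * norm (u t - v t)" using Kb t by (intro mult_right_mono) auto
      finally show "\<bar>a t \<bullet> (?x t - ?y t) + b t \<bullet> (u t - v t)\<bar> \<le> Ka * (K * e) + Kb * norm (u t - v t)"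
        using 1 by linarith
    qed
    also have "\<dots> = (m * (Ka * K) + Kb) * e"
      using Linf_norm_diff_integrable[OF u v] by (simp add: e_def m_def algebra_simps)
    finally show "\<bar>constraint T x0 A B a b c u - constraint T x0 A B a b c v\<bar> \<le> (m * (Ka * K) + Kb) * (LINT t|lebesgue_on {0..T}. norm (u t - v t))"
      by (simp add: e_def)
  qed
qed

text \<open>Countably many exceptional sets merge into one. Closedness of \<open>U\<close> then
  keeps the limit values in \<open>U\<close>, and boundedness of \<open>U\<close> puts the limit in
  \<open>Linf T\<close>.\<close>

lemma admissible_AE_limit:
  assumes U: "compact U" and w: "\<And>k. w k \<in> admissible T U"
    and um: "u \<in> borel_measurable (lebesgue_on {0..T})"
    and lim: "AE t in lebesgue_on {0..T}. (\<lambda>k. w k t) \<longlonglongrightarrow> u t"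
  shows "u \<in> admissible T U"
proof -
  have "AE t in lebesgue_on {0..T}. \<forall>k. w k t \<in> U"
    using w by (simp add: AE_all_countable admissible_def)
  with lim have uU: "AE t in lebesgue_on {0..T}. u t \<in> U"
    by eventually_elim (use compact_imp_closed[OF U] in \<open>auto intro: closed_sequentially\<close>)
  obtain K where K: "\<And>v. v \<in> U \<Longrightarrow> norm v \<le> K"
    using compact_imp_bounded[OF U] unfolding bounded_iff by blast
  have "AE t in lebesgue_on {0..T}. norm (u t) \<le> K" using uU by eventually_elim (rule K)
  then show ?thesis using um uU by (auto simp: admissible_def Linf_def)
qed

lemma L1_tendsto_zero_of_AE_bounded:
  fixes w :: "nat \<Rightarrow> real \<Rightarrow> 'a::euclidean_space"
  assumes w: "\<And>k. w k \<in> Linf T" and u: "u \<in> Linf T"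
    and bnd: "\<And>k. AE t in lebesgue_on {0..T}. norm (w k t) \<le> R"
    and lim: "AE t in lebesgue_on {0..T}. (\<lambda>k. w k t) \<longlonglongrightarrow> u t"
  shows "(\<lambda>k. LINT t|lebesgue_on {0..T}. norm (w k t - u t)) \<longlonglongrightarrow> 0"
proof -
  interpret finite_measure "lebesgue_on {0..T}" by (rule finite_measure_lebesgue_on_Icc)
  have [measurable]: "u \<in> borel_measurable (lebesgue_on {0..T})" "\<And>k. w k \<in> borel_measurable (lebesgue_on {0..T})"
    using u w by (auto simp: Linf_def)
  have "(\<lambda>k. LINT t|lebesgue_on {0..T}. norm (w k t - u t)) \<longlonglongrightarrow> (LINT t|lebesgue_on {0..T}. 0)"
  proof (rule integral_dominated_convergence[where w = "\<lambda>t. R + norm (u t)"])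
    show "integrable (lebesgue_on {0..T}) (\<lambda>t. R + norm (u t))"
      using Linf_integrable[OF u] by simp
    show "AE t in lebesgue_on {0..T}. (\<lambda>k. norm (w k t - u t)) \<longlonglongrightarrow> 0"
      using lim by eventually_elim (simp add: tendsto_norm_zero_iff LIM_zero)
    show "AE t in lebesgue_on {0..T}. norm (norm (w k t - u t)) \<le> R + norm (u t)" for k
      using bnd[of k]
    proof eventually_elim
      case (elim t)
      then show ?case using norm_triangle_ineq4[of "w k t" "u t"] by simp
    qed
  qed measurable
  then show ?thesis by simp
qed

text \<open>The convex-analytic core: controls enter only through an abstract convex combination
  \<open>comb\<close>. Premise \<open>cl\<close> supplies closedness: feasibility at level
  \<open>r\<close> up to any tolerance implies exact feasibility at the same level.\<close>

lemma ereal_concave_usc_value_fun: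
  fixes comb :: "real \<Rightarrow> real \<Rightarrow> 'u \<Rightarrow> 'u \<Rightarrow> 'u"
  assumes comb: "\<And>p q u v. u \<in> \<U> \<Longrightarrow> v \<in> \<U> \<Longrightarrow> 0 \<le> p \<Longrightarrow> 0 \<le> q \<Longrightarrow> p + q = 1 \<Longrightarrow> comb p q u v \<in> \<U>"
    and J: "\<And>p q u v. u \<in> \<U> \<Longrightarrow> v \<in> \<U> \<Longrightarrow> 0 \<le> p \<Longrightarrow> 0 \<le> q \<Longrightarrow> p + q = 1 \<Longrightarrow>
        p * J u + q * J v \<le> J (comb p q u v)"
    and C: "\<And>p q u v. u \<in> \<U> \<Longrightarrow> v \<in> \<U> \<Longrightarrow> 0 \<le> p \<Longrightarrow> 0 \<le> q \<Longrightarrow> p + q = 1 \<Longrightarrow>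
        C (comb p q u v) = p * C u + q * C v"
    and cl: "\<And>\<beta> r. (\<And>e. e > 0 \<Longrightarrow> \<exists>u\<in>\<U>. r \<le> J u \<and> \<bar>C u - \<beta>\<bar> \<le> e) \<Longrightarrow> \<exists>u\<in>\<U>. r \<le> J u \<and> C u = \<beta>"
  defines "D \<equiv> value_dom \<U> C" and "V \<equiv> value_fun \<U> J C"
  shows "is_interval D" "ereal_concave_on D V" "usc_map (subtopology euclidean D) V"
proof -
  have V_upper: "ereal (J u) \<le> V (C u)" if "u \<in> \<U>" for u
    unfolding V_def value_fun_def using that by (intro SUP_upper) auto
  have D: "\<beta> \<in> D \<longleftrightarrow> (\<exists>u\<in>\<U>. C u = \<beta>)" for \<beta> by (auto simp: D_def value_dom_def)
  have cD: "convex D"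
    unfolding convex_def
  proof (intro ballI allI impI)
    fix x y p q :: real assume "x \<in> D" "y \<in> D" and pq: "0 \<le> p" "0 \<le> q" "p + q = 1"
    then obtain u v where "u \<in> \<U>" "C u = x" "v \<in> \<U>" "C v = y" by (auto simp: D)
    then show "p *\<^sub>R x + q *\<^sub>R y \<in> D"
      using comb[of u v p q] C[of u v p q] pq unfolding D by (intro bexI[of _ "comb p q u v"]) auto
  qed
  then show "is_interval D" by (simp add: is_interval_convex_1)
  \<comment> \<open>Positive weights only, since the bounds below divide by \<open>p\<close> and
    \<open>q\<close>. An infinite right-hand side is trivial; a finite one bounds both
    suprema.\<close>
  have V_le: "ereal p * V x + ereal q * V y \<le> V (p *\<^sub>R x + q *\<^sub>R y)"
    if x: "x \<in> D" and y: "y \<in> D" and p: "0 < p" and q: "0 < q" and pq: "p + q = 1" for x y p q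
  proof (cases "V (p *\<^sub>R x + q *\<^sub>R y)")
    case (real z)
    have uv: "p * J u + q * J v \<le> z" if "u \<in> \<U>" "C u = x" "v \<in> \<U>" "C v = y" for u v
    proof -
      have "ereal (J (comb p q u v)) \<le> V (p *\<^sub>R x + q *\<^sub>R y)"
        using V_upper[of "comb p q u v"] comb[of u v p q] C[of u v p q] that p q pq by simp
      then show ?thesis using J[of u v p q] that p q pq real by simp
    qed
    obtain u0 v0 where u0: "u0 \<in> \<U>" "C u0 = x" and v0: "v0 \<in> \<U>" "C v0 = y" using x y by (auto simp: D)
    \<comment> \<open>One supremum at a time: with \<open>v\<close> fixed, over \<open>u\<close>.
      This makes \<open>V x\<close> a real number, which then enters the supremum over
      \<open>v\<close>.\<close>
    have Vx: "V x \<le> ereal ((z - q * J v) / p)" if v: "v \<in> \<U>" "C v = y" for v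
      unfolding V_def value_fun_def
      by (rule SUP_least) (use uv[OF _ _ v] p in \<open>auto simp: field_simps\<close>)
    obtain a where a: "V x = ereal a"
      using Vx[OF v0] V_upper[OF u0(1)] u0(2) by (cases "V x") auto
    have "V y \<le> ereal ((z - p * a) / q)"
      unfolding V_def value_fun_def
      by (rule SUP_least) (use Vx p q in \<open>auto simp: a field_simps\<close>)
    moreover obtain b where b: "V y = ereal b"
      using calculation V_upper[OF v0(1)] v0(2) by (cases "V y") auto
    ultimately have "p * a + q * b \<le> z" using q by (simp add: field_simps)
    then show ?thesis unfolding real a b by simp
  next
    case MInf
    \<comment> \<open>Impossible: the combined level lies in \<open>D\<close>, where
      \<open>V\<close> exceeds \<open>-\<infinity>\<close>.\<close>
    then show ?thesis using convexD[OF cD x y _ _ pq] p q value_dom_eq[of \<U> C J] by (auto simp: D_def V_def)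
  qed simp
  show "ereal_concave_on D V"
    unfolding ereal_concave_on_def
  proof (intro conjI ballI allI impI cD)
    show "V x \<noteq> -\<infinity>" if "x \<in> D" for x
      using that value_dom_eq[of \<U> C J] by (auto simp: D_def V_def)
    fix x y p q :: real
    assume xy: "x \<in> D" "y \<in> D" and pq: "0 \<le> p" "0 \<le> q" "p + q = 1"
    consider "p = 0" "q = 1" | "q = 0" "p = 1" | "0 < p" "0 < q" using pq by linarith
    then show "ereal p * V x + ereal q * V y \<le> V (p *\<^sub>R x + q *\<^sub>R y)"
    proof cases
      case 3
      then show ?thesis using V_le xy pq by blast
    qed (simp_all flip: zero_ereal_def one_ereal_def)
  qed
  show "usc_map (subtopology euclidean D) V"
    unfolding usc_map_def openin_euclidean_subtopology_iff
  proof (intro allI conjI ballI)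
    fix c \<beta> assume "\<beta> \<in> {x \<in> topspace (top_of_set D). V x < c}"
    then have \<beta>: "\<beta> \<in> D" "V \<beta> < c" by auto
    \<comment> \<open>A real level strictly in between: below \<open>c\<close>, it is exceeded by
      some payoff at every level with \<open>V \<ge> c\<close>; above \<open>V \<beta>\<close>, it
      cannot be attained at \<open>\<beta>\<close> itself.\<close>
    obtain r where r: "V \<beta> < ereal r" "ereal r < c" using ereal_dense2[OF \<beta>(2)] by blast
    show "\<exists>e>0. \<forall>\<beta>'\<in>D. dist \<beta>' \<beta> < e \<longrightarrow> \<beta>' \<in> {x \<in> topspace (top_of_set D). V x < c}"
    proof (rule ccontr)
      assume "\<not> ?thesis"
      then have neg: "\<exists>\<beta>'\<in>D. dist \<beta>' \<beta> < e \<and> c \<le> V \<beta>'" if "e > 0" for e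
        using that by (force simp: not_less)
      have "\<exists>u\<in>\<U>. r \<le> J u \<and> \<bar>C u - \<beta>\<bar> \<le> e" if "e > 0" for e
      proof -
        obtain \<beta>' where \<beta>': "dist \<beta>' \<beta> < e" "c \<le> V \<beta>'" using neg[OF \<open>e > 0\<close>] by blast
        then have "ereal r < V \<beta>'" using r(2) by simp
        then obtain u where "u \<in> \<U>" "C u = \<beta>'" "r < J u"
          unfolding V_def value_fun_def less_SUP_iff by auto
        then show ?thesis using \<beta>'(1) by (intro bexI[of _ u]) (auto simp: dist_real_def)
      qed
      then obtain u where "u \<in> \<U>" "r \<le> J u" "C u = \<beta>" using cl by blast
      then have "ereal r \<le> V \<beta>" using V_upper[of u] order_trans[of "ereal r" "ereal (J u)"] by simp
      then show False using r(1) by simp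
    qed
  qed auto
qed

theorem theorem3p5:
  fixes T c :: real
    and x0 :: "real^'n"
    and U :: "(real^'m) set"
    and A :: "real \<Rightarrow> real^'n^'n"
    and B :: "real \<Rightarrow> real^'m^'n"
    and f :: "real \<Rightarrow> (real^'n) \<times> (real^'m) \<Rightarrow> real"
    and \<phi> :: "real^'n \<Rightarrow> real"
    and a :: "real \<Rightarrow> real^'n"
    and b :: "real \<Rightarrow> real^'m"
    and c\<^sub>0 :: "real \<Rightarrow> real"
  assumes "T > 0"
    and "U \<noteq> {}" "compact U" "convex U"
    and "A \<in> borel_measurable (lebesgue_on {0..T})" "bounded (A ` {0..T})"
    and "B \<in> borel_measurable (lebesgue_on {0..T})" "bounded (B ` {0..T})"
    and "\<And>x v. (\<lambda>t. f t (x, v)) \<in> borel_measurable (lebesgue_on {0..T})"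
    and "AE t in lebesgue_on {0..T}. C1 (f t) \<and> concave_on UNIV (f t) \<and> usc_map euclidean (f t)"
    and "c > 0"
    and "\<And>t x v. t \<in> {0..T} \<Longrightarrow> v \<in> U \<Longrightarrow> \<bar>f t (x, v)\<bar> \<le> c * (1 + (norm x)\<^sup>2 + (norm v)\<^sup>2)"
    and "C1 \<phi>" "concave_on UNIV \<phi>" "usc_map euclidean \<phi>"
    and "\<And>x. \<bar>\<phi> x\<bar> \<le> c * (1 + (norm x)\<^sup>2)"
    and "usc_map (subtopology (weak_star T) (admissible T U)) (payoff T x0 A B f \<phi>)"
    and "a \<in> borel_measurable (lebesgue_on {0..T})" "bounded (a ` {0..T})"
    and "b \<in> borel_measurable (lebesgue_on {0..T})" "bounded (b ` {0..T})"
    and "c\<^sub>0 \<in> borel_measurable (lebesgue_on {0..T})" "bounded (c\<^sub>0 ` {0..T})"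
  shows "let \<U> = admissible T U;
             J = payoff T x0 A B f \<phi>;
             C = constraint T x0 A B a b c\<^sub>0;
             V = value_fun \<U> J C;
             D = value_dom \<U> C
         in is_interval D \<and> ereal_concave_on D V \<and> usc_map (subtopology euclidean D) V"
proof -
  have lc: "linear_control T A B" unfolding linear_control_def using assms by blast
  define \<U> where "\<U> = admissible T U"
  define J where "J = payoff T x0 A B f \<phi>"
  define C where "C = constraint T x0 A B a b c\<^sub>0"
  have L: "u \<in> Linf T" if "u \<in> \<U>" for u using that by (simp add: \<U>_def admissible_def)
  obtain R where R: "\<And>v. v \<in> U \<Longrightarrow> norm v \<le> R"
    using compact_imp_bounded[OF \<open>compact U\<close>] unfolding bounded_iff by blast
  have bnd: "AE t in lebesgue_on {0..T}. norm (u t) \<le> R" if "u \<in> \<U>" for u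
  proof -
    have "AE t in lebesgue_on {0..T}. u t \<in> U" using that by (simp add: \<U>_def admissible_def)
    then show ?thesis by eventually_elim (rule R)
  qed
  have f: "AE t in lebesgue_on {0..T}. continuous_on UNIV (f t)" "AE t in lebesgue_on {0..T}. concave_on UNIV (f t)"
    using assms(10) by (auto intro: C1_imp_continuous elim: AE_mp)
  have comb: "(\<lambda>t. p *\<^sub>R u t + q *\<^sub>R v t) \<in> \<U>"
    if "u \<in> \<U>" "v \<in> \<U>" "0 \<le> p" "0 \<le> q" "p + q = 1" for u v and p q :: real
    using admissible_lincomb[OF assms(4)] that by (simp add: \<U>_def)
  have Jc: "p * J u + q * J v \<le> J (\<lambda>t. p *\<^sub>R u t + q *\<^sub>R v t)"
    if "u \<in> \<U>" "v \<in> \<U>" "0 \<le> p" "0 \<le> q" "p + q = 1" for u v and p q :: real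
    unfolding J_def
    by (rule payoff_concave[OF lc assms(3,4,9) f less_imp_le[OF assms(11)] assms(12) assms(14)])
      (use that in \<open>simp_all add: \<U>_def\<close>)
  have Ca: "C (\<lambda>t. p *\<^sub>R u t + q *\<^sub>R v t) = p * C u + q * C v"
    if "u \<in> \<U>" "v \<in> \<U>" "0 \<le> p" "0 \<le> q" "p + q = 1" for u v and p q :: real
    unfolding C_def by (rule constraint_affine[OF lc assms(18-23)]) (use that L in auto)
  have cl: "\<exists>u\<in>\<U>. r \<le> J u \<and> C u = \<beta>"
    if ex: "\<And>e. e > 0 \<Longrightarrow> \<exists>u\<in>\<U>. r \<le> J u \<and> \<bar>C u - \<beta>\<bar> \<le> e" for r \<beta>
  proof -
    \<comment> \<open>The payoff level stays fixed while the tolerance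
      \<open>inverse (real (Suc k))\<close> tends to zero, so a limit in the sense of L1 has
      constraint value exactly \<open>\<beta>\<close>.\<close>
    define S where "S k = {u \<in> \<U>. r \<le> J u \<and> \<bar>C u - \<beta>\<bar> \<le> inverse (real (Suc k))}" for k
    have Sdec: "decseq S"
    proof (rule decseq_SucI)
      fix k
      have "inverse (real (Suc (Suc k))) \<le> inverse (real (Suc k))" by (intro le_imp_inverse_le) auto
      then show "S (Suc k) \<subseteq> S k" unfolding S_def by (blast intro: order_trans)
    qed
    have Sne: "S k \<noteq> {}" for k
      using ex[of "inverse (real (Suc k))"] by (auto simp: S_def)
    have Smid: "(\<lambda>t. (1/2) *\<^sub>R u t + (1/2) *\<^sub>R v t) \<in> S k" if "u \<in> S k" "v \<in> S k" for u v k
    proof -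
      have uv: "u \<in> \<U>" "v \<in> \<U>" "r \<le> J u" "r \<le> J v"
        "\<bar>C u - \<beta>\<bar> \<le> inverse (real (Suc k))" "\<bar>C v - \<beta>\<bar> \<le> inverse (real (Suc k))"
        using that by (auto simp: S_def)
      then show ?thesis
        \<comment> \<open>Concavity keeps the midpoint above \<open>r\<close>, and affinity makes
          its deviation from \<open>\<beta>\<close> the mean of the two deviations.\<close>
        using comb[OF uv(1,2), of "1/2" "1/2"] Jc[OF uv(1,2), of "1/2" "1/2"] Ca[OF uv(1,2), of "1/2" "1/2"]
        unfolding S_def by (auto simp: abs_le_iff)
    qed
    have Sm: "u \<in> borel_measurable (lebesgue_on {0..T})" if "u \<in> S k" for u k
      using L[of u] that by (auto simp: S_def Linf_def)
    have Sb: "AE t in lebesgue_on {0..T}. norm (u t) \<le> R" if "u \<in> S k" for u k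
      using bnd[of u] that by (auto simp: S_def)
    obtain w u where wS: "\<And>k. w k \<in> S k" and um: "u \<in> borel_measurable (lebesgue_on {0..T})"
      and lim: "AE t in lebesgue_on {0..T}. (\<lambda>k. w k t) \<longlonglongrightarrow> u t"
      by (rule finite_measure.nested_midconvex_sequence_converges[OF finite_measure_lebesgue_on_Icc[of 0 T], of S R])
        (erule Sm | erule Sb | rule Sne | rule Sdec | erule (1) Smid | blast)+
    have w: "w k \<in> \<U>" "r \<le> J (w k)" "\<bar>C (w k) - \<beta>\<bar> \<le> inverse (real (Suc k))" for k
      using wS[of k] by (auto simp: S_def)
    have u: "u \<in> \<U>"
      using admissible_AE_limit[OF \<open>compact U\<close> _ um lim] w(1) by (simp add: \<U>_def)
    have "limitin (weak_star T) w u sequentially"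
      by (rule limitin_weak_star_AE[OF L[OF w(1)] L[OF u] bnd[OF w(1)] lim])
    then have "r \<le> J u"
      using usc_map_limit_ge[of "weak_star T" \<U> J w u r] assms(17) u w by (simp add: \<U>_def J_def)
    moreover have "C u = \<beta>"
    proof -
      obtain Q where Q: "\<And>u v. u \<in> Linf T \<Longrightarrow> v \<in> Linf T \<Longrightarrow>
        \<bar>C u - C v\<bar> \<le> Q * (LINT t|lebesgue_on {0..T}. norm (u t - v t))"
        unfolding C_def using constraint_L1_lipschitz[OF lc assms(18-23)] by blast
      have "(\<lambda>k. Q * (LINT t|lebesgue_on {0..T}. norm (w k t - u t))) \<longlonglongrightarrow> 0"
        by (intro tendsto_mult_right_zero L1_tendsto_zero_of_AE_bounded[OF L[OF w(1)] L[OF u] bnd[OF w(1)] lim])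
      then have "(\<lambda>k. C (w k) - C u) \<longlonglongrightarrow> 0"
        by (rule Lim_null_comparison[rotated]) (simp add: Q L u w(1))
      moreover have "(\<lambda>k. C (w k) - \<beta>) \<longlonglongrightarrow> 0"
        by (rule Lim_null_comparison[OF _ LIMSEQ_inverse_real_of_nat]) (use w(3) in simp)
      \<comment> \<open>The numbers \<open>C (w k)\<close> tend to \<open>C u\<close> by L1
        continuity and to \<open>\<beta>\<close> by the choice of the sets.\<close>
      ultimately show ?thesis by (metis LIM_zero_cancel LIMSEQ_unique)
    qed
    ultimately show ?thesis using u by blast
  qed
  show ?thesis
    unfolding Let_def \<U>_def[symmetric] J_def[symmetric] C_def[symmetric]
    by (intro conjI; rule ereal_concave_usc_value_fun[where comb = "\<lambda>p q u v t. p *\<^sub>R u t + q *\<^sub>R v t"];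
        fact comb Jc Ca cl)
qed

end
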